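(* Let $\eta^2=-3$, $\zeta=\frac{-1+\eta}{2}$, and let $X_\eta=\{a^4+a^2e_2(u_1,\dots,u_5)+e_4(u_1,\dots,u_5)=0\}$ in the hyperplane $L_\eta:\ u_1+\cdots+u_5=\eta a$ of $\mathbb{P}^5$, a model of the Burkhardt quartic. The thirty Steiner hyperplanes of the Burkhardt quartic $X_\eta$ other than the ten Steiner hyperplanes $F_i=(a+u_i=0)$ and $G_i=(a-u_i=0)$, $i=1,\dots,5$, are given by the following equations in $L_\eta$: $$K_{pq}:\ u_p+u_q=0,\qquad 1\le p<q\le 5,$$ and $$S_{pq}:\ a-\zeta^2u_p+\zeta u_q=0,\qquad p\neq q,\ 1\le p,q\le 5.$$
   Context: We work over $\mathbb{C}$; $e_r$ is the elementary symmetric polynomial of degree $r$, and $a,u_1,\dots,u_5$ are homogeneous coordinates on $\mathbb{P}^5$. The Burkhardt quartic is the quartic threefold $\{\sigma_1(x_0,\dots,x_5)=\sigma_4(x_0,\dots,x_5)=0\}\subset\mathbb{P}^5$ ($\sigma_r$ elementary symmetric polynomials in six variables), up to projective equivalence; it has exactly $45$ singular points, all nodes, and $X_\eta$ is projectively equivalent to it. A Steiner hyperplane of the Burkhardt quartic is a hyperplane (of the ambient $\mathbb{P}^4$, here $L_\eta$) containing exactly eighteen of its nodes; equivalently (classically), a hyperplane cutting the quartic in a union of four Jacobi planes, a Jacobi plane being a plane contained in the quartic and containing exactly nine nodes. Classically there are exactly forty Steiner hyperplanes. The forty-five nodes of $X_\eta$ are the following points $[a:u_1:\dots:u_5]$ of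 $L_\eta$. (i) For a partition $\{1,\dots,5\}=A\sqcup B\sqcup\{c\}$ with $|A|=|B|=2$, $R_{A,B;c}$ has $a=1$, $u_i=-1$ for $i\in A$, $u_j=1$ for $j\in B$, $u_c=\eta$. (ii) For $C=\{p,q\}\subset\{1,\dots,5\}$ with $p\ne q$, $T_C$ has $a=0$, $u_i=0$ for $i\notin C$, $u_p=1$, $u_q=-1$. (iii) For $c\in\{1,\dots,5\}$, $E_c$ has $a=1$, $u_c=-\eta/3$, $u_i=\eta/3$ for $i\neq c$. *)

theory Defs
  imports "HOL-Analysis.Analysis"
begin

definition esym :: "nat \<Rightarrow> 'i set \<Rightarrow> ('i \<Rightarrow> complex) \<Rightarrow> complex" where
  "esym r I x = (\<Sum>J | J \<subseteq> I \<and> card J = r. \<Prod>j\<in>J. x j)"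

text \<open>
  A linear subspace \<open>V\<close> of \<open>complex ^ 'n\<close> stands for its projectivisation: points are
  the lines \<open>vec.span {x}\<close> with \<open>x \<noteq> 0\<close>, and a hyperplane of \<open>P(V)\<close> is a linear subspace of
  codimension one in \<open>V\<close>. A hypersurface in \<open>P(V)\<close> is given by its equation, a homogeneous
  polynomial function \<open>f\<close> restricted to \<open>V\<close>.
\<close>

definition hyperplane_of :: "(complex ^ 'n) set \<Rightarrow> (complex ^ 'n) set \<Rightarrow> bool" where
  "hyperplane_of V H \<longleftrightarrow> vec.subspace H \<and> H \<subseteq> V \<and> vec.dim H + 1 = vec.dim V"

definition dir_deriv ::
    "(complex ^ 'n \<Rightarrow> complex) \<Rightarrow> complex ^ 'n \<Rightarrow> complex ^ 'n \<Rightarrow> complex" where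
  "dir_deriv f v x = deriv (\<lambda>t. f (x + t *s v)) 0"

definition singular_at :: "(complex ^ 'n) set \<Rightarrow> (complex ^ 'n \<Rightarrow> complex) \<Rightarrow> complex ^ 'n \<Rightarrow> bool" where
  "singular_at V f x \<longleftrightarrow> x \<in> V \<and> x \<noteq> 0 \<and> f x = 0 \<and> (\<forall>v\<in>V. dir_deriv f v x = 0)"

text \<open>
  A node is an ordinary double point. By Euler's formula the Hessian form of \<open>f\<close> on \<open>V\<close> at a
  singular point \<open>x\<close> always has \<open>x\<close> in its radical; it induces the quadratic part of the local
  equation on the tangent space \<open>V / \<langle>x\<rangle>\<close> of \<open>P(V)\<close>, which is nondegenerate exactly when the
  radical is spanned by \<open>x\<close>.
\<close>

definition node_at :: "(complex ^ 'n) set \<Rightarrow> (complex ^ 'n \<Rightarrow> complex) \<Rightarrow> complex ^ 'n \<Rightarrow> bool" where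
  "node_at V f x \<longleftrightarrow> singular_at V f x \<and>
     {v \<in> V. \<forall>w\<in>V. dir_deriv (dir_deriv f v) w x = 0} = vec.span {x}"

definition nodes :: "(complex ^ 'n) set \<Rightarrow> (complex ^ 'n \<Rightarrow> complex) \<Rightarrow> (complex ^ 'n) set set" where
  "nodes V f = {vec.span {x} |x. node_at V f x}"

definition steiner_hyperplane ::
    "(complex ^ 'n) set \<Rightarrow> (complex ^ 'n \<Rightarrow> complex) \<Rightarrow> (complex ^ 'n) set \<Rightarrow> bool" where
  "steiner_hyperplane V f H \<longleftrightarrow> hyperplane_of V H \<and> card {P \<in> nodes V f. P \<subseteq> H} = 18"

text \<open>
  The homogeneous coordinates on five-dimensional projective space are \<open>a = x $ 0\<close> and
  \<open>u\<^sub>i = x $ i\<close> for \<open>i\<close> in \<open>{1..5}\<close>. Here \<open>6\<close> is the index type with the six elements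
  \<open>0 < 1 < \<dots> < 5\<close>.
\<close>

definition L_space :: "complex \<Rightarrow> (complex ^ 6) set" where
  "L_space \<eta> = {x. (\<Sum>i\<in>{1..5}. x $ i) = \<eta> * x $ 0}"

definition X_form :: "complex ^ 6 \<Rightarrow> complex" where
  "X_form x = (x $ 0) ^ 4 + (x $ 0) ^ 2 * esym 2 {1..5} (($) x) + esym 4 {1..5} (($) x)"

definition steiner_hyperplanes_X :: "complex \<Rightarrow> (complex ^ 6) set set" where
  "steiner_hyperplanes_X \<eta> = {H. steiner_hyperplane (L_space \<eta>) X_form H}"

definition F_hyp :: "complex \<Rightarrow> 6 \<Rightarrow> (complex ^ 6) set" where
  "F_hyp \<eta> i = {x \<in> L_space \<eta>. x $ 0 + x $ i = 0}"

definition G_hyp :: "complex \<Rightarrow> 6 \<Rightarrow> (complex ^ 6) set" where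
  "G_hyp \<eta> i = {x \<in> L_space \<eta>. x $ 0 - x $ i = 0}"

definition K_hyp :: "complex \<Rightarrow> 6 \<Rightarrow> 6 \<Rightarrow> (complex ^ 6) set" where
  "K_hyp \<eta> p q = {x \<in> L_space \<eta>. x $ p + x $ q = 0}"

definition S_hyp :: "complex \<Rightarrow> complex \<Rightarrow> 6 \<Rightarrow> 6 \<Rightarrow> (complex ^ 6) set" where
  "S_hyp \<eta> \<zeta> p q = {x \<in> L_space \<eta>. x $ 0 - \<zeta>\<^sup>2 * x $ p + \<zeta> * x $ q = 0}"

definition FG_hyps :: "complex \<Rightarrow> (complex ^ 6) set set" where
  "FG_hyps \<eta> = {F_hyp \<eta> i |i. i \<in> {1..5}} \<union> {G_hyp \<eta> i |i. i \<in> {1..5}}"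

end

theory Submission
  imports Defs
begin

text \<open>
  On \<open>L\<^sub>\<eta>\<close>, a point of \<open>X\<^sub>\<eta>\<close> is singular iff \<open>\<partial>\<^sub>a + \<eta> \<partial>\<^sub>i\<close> vanishes there for all \<open>i\<close>. Subtracting two of these
  conditions gives \<open>(u\<^sub>i - u\<^sub>j) (a\<^sup>2 + e\<^sub>2(the other three u's)) = 0\<close>, so the solutions can be listed according to
  which of the \<open>u\<^sub>i\<close> coincide: the patterns \<open>3+1+1\<close>, \<open>4+1\<close> and \<open>2+2+1\<close> give the nodes \<open>T\<close>, \<open>E\<close> and \<open>R\<close>,
  and the other patterns give nothing.

  A hyperplane of \<open>L\<^sub>\<eta>\<close> is the kernel of a functional \<open>\<alpha> a + \<Sum> h\<^sub>i u\<^sub>i\<close>, unique up to scaling and up to adding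
  a multiple of \<open>\<Sum> u\<^sub>i - \<eta> a\<close>. It contains \<open>T\<^bsub>{p,q}\<^esub>\<close> iff \<open>h\<^sub>p = h\<^sub>q\<close>, and the number of \<open>E\<close> and \<open>R\<close> it contains
  is bounded in terms of the coincidences among the \<open>h\<^sub>i\<close>. Eighteen nodes are only reached by the patterns \<open>4+1\<close>
  (which gives \<open>F\<close> and \<open>G\<close>), \<open>3+2\<close> (which gives \<open>K\<close>) and \<open>3+1+1\<close> (which gives \<open>S\<close>, all bounds being attained).
\<close>

section \<open>The quartic in coordinates\<close>

text \<open>The type \<open>6\<close> consists of the residues modulo 6, ordered by their
  representatives from 0 to 5. So 5 is the largest element and only 0 lies below 1.\<close>

lemma index_set: "{1..5::6} = UNIV - {0}"
proof -
  have "x \<ge> 1 \<longleftrightarrow> x \<noteq> 0" "x \<le> 5" for x :: 6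
    using Rep_bit0[of x] bit0.Rep_numeral[of "num.Bit1 (num.Bit0 num.One)", where 'a=3]
    by (auto simp: less_eq_bit0_def bit0.Rep_1 bit0.Rep_0 bit0.Rep_inject_sym)
  then show ?thesis by auto
qed

text \<open>An arbitrary ordering of the five indices. Statements symmetric in the u-coordinates
  become polynomial identities in named variables, and permuting the enumeration takes the place of
  the symmetric group.\<close>

definition enum5 :: "6 \<Rightarrow> 6 \<Rightarrow> 6 \<Rightarrow> 6 \<Rightarrow> 6 \<Rightarrow> bool" where
  "enum5 i j k l m \<longleftrightarrow> distinct [i, j, k, l, m] \<and> {1..5} = {i, j, k, l, m}"

lemma esym_0: "finite I \<Longrightarrow> esym 0 I x = 1"
proof -
  assume "finite I"
  then have "{J. J \<subseteq> I \<and> card J = 0} = {{}}" by (auto dest: finite_subset)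
  then show ?thesis by (simp add: esym_def)
qed

lemma esym_Suc_empty: "esym (Suc r) {} x = 0"
proof -
  have "{J. J \<subseteq> {} \<and> card J = Suc r} = ({} :: 'a set set)" by auto
  then show ?thesis unfolding esym_def by (metis sum.empty)
qed

lemma subsets_card_Suc_insert:
  assumes "finite I" "i \<notin> I"
  shows "{J. J \<subseteq> insert i I \<and> card J = Suc r} =
    {J. J \<subseteq> I \<and> card J = Suc r} \<union> insert i ` {J. J \<subseteq> I \<and> card J = r}" (is "?A = ?B \<union> ?C")
proof (intro equalityI subsetI)
  fix J assume J: "J \<in> ?A"
  then have fin: "finite J" using assms by (auto dest: finite_subset)
  show "J \<in> ?B \<union> ?C"
  proof (cases "i \<in> J")
    case True
    then have "J = insert i (J - {i})" "J - {i} \<subseteq> I" "card (J - {i}) = r" using J fin by auto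
    then show ?thesis by blast
  qed (use J in auto)
next
  fix J assume J: "J \<in> ?B \<union> ?C"
  then show "J \<in> ?A"
  proof
    assume "J \<in> ?C"
    then obtain K where K: "J = insert i K" "K \<subseteq> I" "card K = r" by auto
    then have "i \<notin> K" "finite K" using assms by (auto dest: finite_subset)
    then show ?thesis using K by auto
  qed auto
qed

text \<open>Subsets of size \<open>Suc r\<close> either avoid \<open>i\<close> or contain it.
  Iterating this recursion expands e_2 and e_4 in five variables.\<close>

lemma esym_Suc_insert:
  assumes "finite I" "i \<notin> I"
  shows "esym (Suc r) (insert i I) x = esym (Suc r) I x + x i * esym r I x"
proof -
  have inj: "inj_on (insert i) {J. J \<subseteq> I \<and> card J = r}"
    using assms(2) by (auto simp: inj_on_def)
  have "esym (Suc r) (insert i I) x = esym (Suc r) I x + (\<Sum>J \<in> insert i ` {J. J \<subseteq> I \<and> card J = r}. \<Prod>j\<in>J. x j)"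
    unfolding esym_def subsets_card_Suc_insert[OF assms]
    using assms by (intro sum.union_disjoint) auto
  also have "(\<Sum>J \<in> insert i ` {J. J \<subseteq> I \<and> card J = r}. \<Prod>j\<in>J. x j) =
      (\<Sum>J | J \<subseteq> I \<and> card J = r. x i * (\<Prod>j\<in>J. x j))"
    unfolding sum.reindex[OF inj] o_def
  proof (rule sum.cong)
    fix J assume "J \<in> {J. J \<subseteq> I \<and> card J = r}"
    then have "i \<notin> J" "finite J" using assms by (auto dest: finite_subset)
    then show "(\<Prod>j\<in>insert i J. x j) = x i * (\<Prod>j\<in>J. x j)" by simp
  qed simp
  finally show ?thesis by (simp add: esym_def sum_distrib_left)
qed

lemma X_form_enum:
  assumes "enum5 i j k l m"
  shows "X_form x = (x$0)^4 + (x$0)^2 * (x$i * x$j + x$i * x$k + x$i * x$l + x$i * x$m + x$j * x$k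
      + x$j * x$l + x$j * x$m + x$k * x$l + x$k * x$m + x$l * x$m)
    + (x$i * x$j * x$k * x$l + x$i * x$j * x$k * x$m + x$i * x$j * x$l * x$m + x$i * x$k * x$l * x$m
      + x$j * x$k * x$l * x$m)"
  using assms unfolding enum5_def X_form_def
  by (simp add: numeral_eq_Suc esym_Suc_insert esym_0 esym_Suc_empty) (simp add: algebra_simps)

lemma L_space_enum:
  assumes "enum5 i j k l m"
  shows "x \<in> L_space \<eta> \<longleftrightarrow> x$i + x$j + x$k + x$l + x$m = \<eta> * x$0"
  using assms unfolding enum5_def L_space_def by (simp add: add.assoc)

text \<open>The mixed second derivative of the quartic in two of the u-coordinates;
  \<open>p\<close>, \<open>q\<close>, \<open>r\<close> are the other three.\<close>

definition qcoef :: "complex \<Rightarrow> complex \<Rightarrow> complex \<Rightarrow> complex \<Rightarrow> complex" where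
  "qcoef a p q r = a\<^sup>2 + p * q + p * r + q * r"

text \<open>The partial derivative in one u-coordinate, a^2 e_1 + e_3 of the other four. Likewise
  \<open>agrad\<close> is the partial derivative in a.\<close>

definition ugrad :: "complex \<Rightarrow> complex \<Rightarrow> complex \<Rightarrow> complex \<Rightarrow> complex \<Rightarrow> complex" where
  "ugrad a p q r s = a\<^sup>2 * (p + q + r + s) + p * q * r + p * q * s + p * r * s + q * r * s"

definition agrad :: "complex \<Rightarrow> complex \<Rightarrow> complex \<Rightarrow> complex \<Rightarrow> complex \<Rightarrow> complex \<Rightarrow> complex" where
  "agrad a p q r s t = 4 * a ^ 3 + 2 * a * (p * q + p * r + p * s + p * t + q * r + q * s + q * t
     + r * s + r * t + s * t)"

lemma dir_deriv_X_form:
  assumes "enum5 i j k l m"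
  shows "dir_deriv X_form v x =
    agrad (x$0) (x$i) (x$j) (x$k) (x$l) (x$m) * v$0 +
    ugrad (x$0) (x$j) (x$k) (x$l) (x$m) * v$i + ugrad (x$0) (x$i) (x$k) (x$l) (x$m) * v$j +
    ugrad (x$0) (x$i) (x$j) (x$l) (x$m) * v$k + ugrad (x$0) (x$i) (x$j) (x$k) (x$m) * v$l +
    ugrad (x$0) (x$i) (x$j) (x$k) (x$l) * v$m"
  unfolding dir_deriv_def X_form_enum[OF assms] agrad_def ugrad_def
  by (rule DERIV_imp_deriv, (rule derivative_eq_intros refl | simp)+)
     (simp add: algebra_simps power2_eq_square power3_eq_cube)

lemma dir_deriv2_X_form:
  assumes "enum5 i j k l m"
  shows "dir_deriv (dir_deriv X_form v) w x =
    ((12 * (x$0)\<^sup>2 + 2 * (x$i * x$j + x$i * x$k + x$i * x$l + x$i * x$m + x$j * x$k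
      + x$j * x$l + x$j * x$m + x$k * x$l + x$k * x$m + x$l * x$m)) * v$0 +
      2 * x$0 * ((x$j + x$k + x$l + x$m) * v$i + (x$i + x$k + x$l + x$m) * v$j
       + (x$i + x$j + x$l + x$m) * v$k + (x$i + x$j + x$k + x$m) * v$l + (x$i + x$j + x$k + x$l) * v$m)) * w$0 +
    (2 * x$0 * (x$j + x$k + x$l + x$m) * v$0 + qcoef (x$0) (x$k) (x$l) (x$m) * v$j +
      qcoef (x$0) (x$j) (x$l) (x$m) * v$k + qcoef (x$0) (x$j) (x$k) (x$m) * v$l +
      qcoef (x$0) (x$j) (x$k) (x$l) * v$m) * w$i +
    (2 * x$0 * (x$i + x$k + x$l + x$m) * v$0 + qcoef (x$0) (x$k) (x$l) (x$m) * v$i +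
      qcoef (x$0) (x$i) (x$l) (x$m) * v$k + qcoef (x$0) (x$i) (x$k) (x$m) * v$l +
      qcoef (x$0) (x$i) (x$k) (x$l) * v$m) * w$j +
    (2 * x$0 * (x$i + x$j + x$l + x$m) * v$0 + qcoef (x$0) (x$j) (x$l) (x$m) * v$i +
      qcoef (x$0) (x$i) (x$l) (x$m) * v$j + qcoef (x$0) (x$i) (x$j) (x$m) * v$l +
      qcoef (x$0) (x$i) (x$j) (x$l) * v$m) * w$k +
    (2 * x$0 * (x$i + x$j + x$k + x$m) * v$0 + qcoef (x$0) (x$j) (x$k) (x$m) * v$i +
      qcoef (x$0) (x$i) (x$k) (x$m) * v$j + qcoef (x$0) (x$i) (x$j) (x$m) * v$k +
      qcoef (x$0) (x$i) (x$j) (x$k) * v$m) * w$l +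
    (2 * x$0 * (x$i + x$j + x$k + x$l) * v$0 + qcoef (x$0) (x$j) (x$k) (x$l) * v$i +
      qcoef (x$0) (x$i) (x$k) (x$l) * v$j + qcoef (x$0) (x$i) (x$j) (x$l) * v$k +
      qcoef (x$0) (x$i) (x$j) (x$k) * v$l) * w$m"
  unfolding dir_deriv_X_form[OF assms, abs_def] agrad_def ugrad_def qcoef_def
  unfolding dir_deriv_def
  by (rule DERIV_imp_deriv, (rule derivative_eq_intros refl | simp)+)
     (simp add: algebra_simps power2_eq_square power3_eq_cube)

lemma enum5_cover: "enum5 i j k l m \<Longrightarrow> n = 0 \<or> n = i \<or> n = j \<or> n = k \<or> n = l \<or> n = m"
  using index_set unfolding enum5_def by auto

lemma enum5_nonzero: "enum5 i j k l m \<Longrightarrow> i \<noteq> 0 \<and> j \<noteq> 0 \<and> k \<noteq> 0 \<and> l \<noteq> 0 \<and> m \<noteq> 0"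
  using index_set unfolding enum5_def by auto

lemma enum5_swap:
  assumes "enum5 i j k l m"
  shows "enum5 j i k l m" "enum5 i k j l m" "enum5 i j l k m" "enum5 i j k m l"
  using assms unfolding enum5_def by auto

text \<open>The test vector has a = 1, u_i = \<eta> and zeros elsewhere, which satisfies the
  equation of L.\<close>

lemma L_annihilator_coord:
  assumes e: "enum5 i j k l m"
    and *: "\<And>v. v \<in> L_space \<eta> \<Longrightarrow> c0 * v$0 + c1 * v$i + c2 * v$j + c3 * v$k + c4 * v$l + c5 * v$m = 0"
  shows "c0 + \<eta> * c1 = 0"
proof -
  let ?v = "axis 0 1 + \<eta> *s axis i 1 :: complex^6"
  have ne: "i \<noteq> j" "i \<noteq> k" "i \<noteq> l" "i \<noteq> m" using e unfolding enum5_def by auto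
  have "?v \<in> L_space \<eta>" using enum5_nonzero[OF e] ne by (simp add: L_space_enum[OF e] axis_def)
  from *[OF this] show ?thesis using enum5_nonzero[OF e] ne by (simp add: axis_def mult.commute)
qed

text \<open>The functionals vanishing on L are the multiples of u_1 + ... + u_5 - \<eta> a. This
  turns conditions on the gradient or Hessian in all directions of L into five scalar
  equations.\<close>

lemma L_annihilator:
  assumes e: "enum5 i j k l m" and "\<eta> \<noteq> 0"
  shows "(\<forall>v\<in>L_space \<eta>. c0 * v$0 + c1 * v$i + c2 * v$j + c3 * v$k + c4 * v$l + c5 * v$m = 0) \<longleftrightarrow>
    c0 + \<eta> * c1 = 0 \<and> c0 + \<eta> * c2 = 0 \<and> c0 + \<eta> * c3 = 0 \<and> c0 + \<eta> * c4 = 0 \<and> c0 + \<eta> * c5 = 0"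
    (is "?A = ?B")
proof
  assume A: ?A
  have e2: "enum5 j i k l m" and e3: "enum5 k i j l m" and e4: "enum5 l i j k m" and e5: "enum5 m i j k l"
    using e unfolding enum5_def by auto
  show ?B
    using L_annihilator_coord[OF e, of \<eta> c0 c1 c2 c3 c4 c5]
      L_annihilator_coord[OF e2, of \<eta> c0 c2 c1 c3 c4 c5]
      L_annihilator_coord[OF e3, of \<eta> c0 c3 c1 c2 c4 c5]
      L_annihilator_coord[OF e4, of \<eta> c0 c4 c1 c2 c3 c5]
      L_annihilator_coord[OF e5, of \<eta> c0 c5 c1 c2 c3 c4] A
    by (simp add: algebra_simps)
next
  assume B: ?B
  show ?A
  proof
    fix v assume "v \<in> L_space \<eta>"
    then have v: "v$i + v$j + v$k + v$l + v$m = \<eta> * v$0" by (simp add: L_space_enum[OF e])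
    have "c2 = c1" "c3 = c1" "c4 = c1" "c5 = c1" and c0: "c0 = - \<eta> * c1"
      using B \<open>\<eta> \<noteq> 0\<close> by (simp_all add: add_eq_0_iff) (metis mult_left_cancel)+
    then have "c0 * v$0 + c1 * v$i + c2 * v$j + c3 * v$k + c4 * v$l + c5 * v$m =
      c1 * ((v$i + v$j + v$k + v$l + v$m) - \<eta> * v$0)" by (simp add: algebra_simps)
    then show "c0 * v$0 + c1 * v$i + c2 * v$j + c3 * v$k + c4 * v$l + c5 * v$m = 0"
      using v by simp
  qed
qed

section \<open>The forty-five nodes\<close>

lemma vec_eq_enum:
  assumes "enum5 i j k l m"
  shows "v = w \<longleftrightarrow> v$0 = w$0 \<and> v$i = w$i \<and> v$j = w$j \<and> v$k = w$k \<and> v$l = w$l \<and> v$m = w$m" (is "_ \<longleftrightarrow> ?R")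
proof
  assume R: ?R
  have "v$n = w$n" for n using enum5_cover[OF assms, of n] R by (elim disjE) simp_all
  then show "v = w" by (simp add: vec_eq_iff)
qed simp

text \<open>Euler's formula for the gradient, which is homogeneous of degree 3. At a singular point
  x of the quartic in L it puts every multiple of x into the radical of the Hessian form.\<close>

lemma euler_hessian:
  assumes "enum5 i j k l m"
  shows "dir_deriv (dir_deriv X_form (c *s x)) w x = 3 * c * dir_deriv X_form w x"
  unfolding dir_deriv2_X_form[OF assms] dir_deriv_X_form[OF assms] agrad_def ugrad_def qcoef_def
  by (simp add: algebra_simps power2_eq_square power3_eq_cube)

lemma euler_gradient:
  assumes "enum5 i j k l m"
  shows "dir_deriv X_form x x = 4 * X_form x"
  unfolding dir_deriv_X_form[OF assms] X_form_enum[OF assms] agrad_def ugrad_def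
  by (simp add: algebra_simps power2_eq_square power3_eq_cube power4_eq_xxxx)

text \<open>\<open>L_annihilator\<close> makes the gradient condition explicit, and the equation of
  the quartic follows from it by \<open>euler_gradient\<close>, because x is itself a direction in
  L.\<close>

lemma singular_at_X_form:
  assumes e: "enum5 i j k l m" and "\<eta> \<noteq> 0"
  shows "singular_at (L_space \<eta>) X_form x \<longleftrightarrow> x \<in> L_space \<eta> \<and> x \<noteq> 0 \<and>
    (let g = agrad (x$0) (x$i) (x$j) (x$k) (x$l) (x$m) in
     g + \<eta> * ugrad (x$0) (x$j) (x$k) (x$l) (x$m) = 0 \<and> g + \<eta> * ugrad (x$0) (x$i) (x$k) (x$l) (x$m) = 0 \<and>
     g + \<eta> * ugrad (x$0) (x$i) (x$j) (x$l) (x$m) = 0 \<and> g + \<eta> * ugrad (x$0) (x$i) (x$j) (x$k) (x$m) = 0 \<and>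
     g + \<eta> * ugrad (x$0) (x$i) (x$j) (x$k) (x$l) = 0)"
  unfolding Let_def L_annihilator[OF e \<open>\<eta> \<noteq> 0\<close>, symmetric] dir_deriv_X_form[OF e, symmetric] singular_at_def
  using euler_gradient[OF e, of x] by auto

text \<open>Leaves one inclusion of the radical to be checked for each node; the other is
  \<open>euler_hessian\<close>.\<close>

lemma node_atI:
  assumes e: "enum5 i j k l m" and "\<eta> \<noteq> 0" and s: "singular_at (L_space \<eta>) X_form x"
    and rad: "\<And>v. v \<in> L_space \<eta> \<Longrightarrow> \<forall>w\<in>L_space \<eta>. dir_deriv (dir_deriv X_form v) w x = 0 \<Longrightarrow> \<exists>c. v = c *s x"
  shows "node_at (L_space \<eta>) X_form x"
proof -
  have "{v \<in> L_space \<eta>. \<forall>w\<in>L_space \<eta>. dir_deriv (dir_deriv X_form v) w x = 0} = range (\<lambda>c. c *s x)"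
    using s by (auto dest: rad simp: singular_at_def euler_hessian[OF e])
      (simp add: L_space_def sum_distrib_left[symmetric])
  then show ?thesis using s by (simp add: node_at_def vec.span_singleton)
qed

lemma node_T:
  assumes e: "enum5 i j k l m" and "\<eta> \<noteq> 0"
    and x: "x$0 = 0" "x$i = 1" "x$j = -1" "x$k = 0" "x$l = 0" "x$m = 0"
  shows "node_at (L_space \<eta>) X_form x"
proof (rule node_atI[OF e \<open>\<eta> \<noteq> 0\<close>])
  have "x \<noteq> 0" using x by auto
  then show "singular_at (L_space \<eta>) X_form x"
    using x by (simp add: singular_at_X_form[OF e \<open>\<eta> \<noteq> 0\<close>] L_space_enum[OF e] agrad_def ugrad_def)
  fix v assume v: "v \<in> L_space \<eta>" and "\<forall>w\<in>L_space \<eta>. dir_deriv (dir_deriv X_form v) w x = 0"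
  then have h: "\<forall>w\<in>L_space \<eta>. dir_deriv (dir_deriv X_form v) w x = 0" by simp
  note eqs = h[unfolded dir_deriv2_X_form[OF e] L_annihilator[OF e \<open>\<eta> \<noteq> 0\<close>] qcoef_def x power2_eq_square]
  have sv: "v$i + v$j + v$k + v$l + v$m = \<eta> * v$0" using v by (simp add: L_space_enum[OF e])
  \<comment> \<open>At T the only nonzero second derivatives are the one in a twice, which is -2,
    and those in two of u_k, u_l, u_m, which are -1. The condition for i therefore isolates
    \<open>v$0\<close>, and those for k, l, m leave pairwise sums.\<close>
  have v0: "v$0 = 0" using eqs by simp
  have "\<eta> * (v$l + v$m) = 0" "\<eta> * (v$k + v$m) = 0" "\<eta> * (v$k + v$l) = 0"
    using eqs v0 by algebra+
  then have "v$l + v$m = 0" "v$k + v$m = 0" "v$k + v$l = 0" using \<open>\<eta> \<noteq> 0\<close> by simp_all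
  then have "v$k = 0" "v$l = 0" "v$m = 0" by algebra+
  then have "v$0 = 0 \<and> v$k = 0 \<and> v$l = 0 \<and> v$m = 0 \<and> v$j = - v$i"
    using v0 sv by (simp add: add_eq_0_iff)
  then show "\<exists>c. v = c *s x"
    using x by (intro exI[of _ "v$i"]) (simp add: vec_eq_enum[OF e])
qed

lemma node_R:
  assumes e: "enum5 i j k l m" and \<eta>: "\<eta>\<^sup>2 = -3"
    and x: "x$0 = 1" "x$i = -1" "x$j = -1" "x$k = 1" "x$l = 1" "x$m = \<eta>"
  shows "node_at (L_space \<eta>) X_form x"
proof -
  have "\<eta> \<noteq> 0" using \<eta> by auto
  show ?thesis
  proof (rule node_atI[OF e \<open>\<eta> \<noteq> 0\<close>])
    have "x \<noteq> 0" using x by auto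
    then show "singular_at (L_space \<eta>) X_form x"
      using x by (simp add: singular_at_X_form[OF e \<open>\<eta> \<noteq> 0\<close>] L_space_enum[OF e] agrad_def ugrad_def)
    fix v assume v: "v \<in> L_space \<eta>" and "\<forall>w\<in>L_space \<eta>. dir_deriv (dir_deriv X_form v) w x = 0"
    then have h: "\<forall>w\<in>L_space \<eta>. dir_deriv (dir_deriv X_form v) w x = 0" by simp
    note eqs = h[unfolded dir_deriv2_X_form[OF e] L_annihilator[OF e \<open>\<eta> \<noteq> 0\<close>] qcoef_def x power2_eq_square]
    have sv: "v$i + v$j + v$k + v$l + v$m = \<eta> * v$0" using v by (simp add: L_space_enum[OF e])
    have n: "\<eta> - 1 \<noteq> 0" "\<eta> + 1 \<noteq> 0" using \<eta> by (auto simp: add_eq_0_iff2)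
    \<comment> \<open>Every second derivative involving u_m vanishes at R, so the condition for m is
      the a-component alone. Subtracting it from the conditions for i, j, k, l gives these four
      equations.\<close>
    have "2 * \<eta> * (\<eta> + 1) * (v$0 + v$j) = 0" "2 * \<eta> * (\<eta> + 1) * (v$0 + v$i) = 0"
      "2 * \<eta> * (\<eta> - 1) * (v$0 - v$l) = 0" "2 * \<eta> * (\<eta> - 1) * (v$0 - v$k) = 0"
      using eqs \<eta> unfolding power2_eq_square by algebra+
    then have "v$j = - v$0" "v$i = - v$0" "v$l = v$0" "v$k = v$0"
      using \<open>\<eta> \<noteq> 0\<close> n by (simp_all add: add_eq_0_iff)
    then have "v$i = - v$0 \<and> v$j = - v$0 \<and> v$k = v$0 \<and> v$l = v$0 \<and> v$m = \<eta> * v$0"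
      using sv by simp
    then show "\<exists>c. v = c *s x"
      using x by (intro exI[of _ "v$0"]) (simp add: vec_eq_enum[OF e])
  qed
qed

lemma node_E:
  assumes e: "enum5 i j k l m" and \<eta>: "\<eta>\<^sup>2 = -3"
    and x: "x$0 = 1" "x$i = \<eta> / 3" "x$j = \<eta> / 3" "x$k = \<eta> / 3" "x$l = \<eta> / 3" "x$m = - (\<eta> / 3)"
  shows "node_at (L_space \<eta>) X_form x"
proof -
  have "\<eta> \<noteq> 0" using \<eta> by auto
  \<comment> \<open>With \<eta> = 3 t and 3 t^2 = -1 all equations become free of
    denominators.\<close>
  define t where "t = \<eta> / 3"
  have t: "\<eta> = 3 * t" and t2: "3 * (t * t) = -1" using \<eta> by (auto simp: t_def power2_eq_square)
  note x = x[folded t_def]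
  have g: "agrad 1 t t t t (-t) + \<eta> * ugrad 1 t t t (-t) = 0" "agrad 1 t t t t (-t) + \<eta> * ugrad 1 t t t t = 0"
    using t2 unfolding agrad_def ugrad_def t power2_eq_square power3_eq_cube by algebra+
  show ?thesis
  proof (rule node_atI[OF e \<open>\<eta> \<noteq> 0\<close>])
    have "x \<noteq> 0" using x by auto
    then show "singular_at (L_space \<eta>) X_form x"
      using g by (simp add: singular_at_X_form[OF e \<open>\<eta> \<noteq> 0\<close>] L_space_enum[OF e] x) (simp add: t)
    fix v assume v: "v \<in> L_space \<eta>" and "\<forall>w\<in>L_space \<eta>. dir_deriv (dir_deriv X_form v) w x = 0"
    then have h: "\<forall>w\<in>L_space \<eta>. dir_deriv (dir_deriv X_form v) w x = 0" by simp
    note eqs = h[unfolded dir_deriv2_X_form[OF e] L_annihilator[OF e \<open>\<eta> \<noteq> 0\<close>] qcoef_def x power2_eq_square]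
    have sv: "v$i + v$j + v$k + v$l + v$m = \<eta> * v$0" using v by (simp add: L_space_enum[OF e])
    \<comment> \<open>Up to nonzero constants these are the condition for i minus those for j, k, l
      and m. At E the mixed second derivatives in u_m and another u vanish; those in two of u_i,
      u_j, u_k, u_l equal 1 - t^2 = 4/3.\<close>
    have "\<eta> * (v$i - v$j) = 0" "\<eta> * (v$i - v$k) = 0" "\<eta> * (v$i - v$l) = 0"
      "\<eta> * (v$j + v$k + v$l - \<eta> * v$0) = 0"
      using eqs t2 unfolding t by algebra+
    then have "v$i = v$j" "v$i = v$k" "v$i = v$l" "v$j + v$k + v$l = \<eta> * v$0"
      using \<open>\<eta> \<noteq> 0\<close> by simp_all
    then have i: "v$i = t * v$0" and "v$j = t * v$0" "v$k = t * v$0" "v$l = t * v$0"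
      unfolding t by auto
    moreover from this have "v$m = - t * v$0"
      using sv unfolding t by (simp add: algebra_simps eq_neg_iff_add_eq_0)
    ultimately show "\<exists>c. v = c *s x"
      using x by (intro exI[of _ "v$0"]) (simp add: vec_eq_enum[OF e])
  qed
qed

section \<open>Coincidence patterns of values\<close>

definition pattern3 :: "'a \<Rightarrow> 'a \<Rightarrow> 'a \<Rightarrow> bool" where
  "pattern3 a b c \<longleftrightarrow> (a = b \<and> b = c) \<or> (a = b \<and> b \<noteq> c) \<or> distinct [a, b, c]"

definition pattern4 :: "'a \<Rightarrow> 'a \<Rightarrow> 'a \<Rightarrow> 'a \<Rightarrow> bool" where
  "pattern4 a b c d \<longleftrightarrow> (a = b \<and> b = c \<and> c = d) \<or> (a = b \<and> b = c \<and> c \<noteq> d) \<or>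
    (a = b \<and> c = d \<and> b \<noteq> c) \<or> (a = b \<and> distinct [b, c, d]) \<or> distinct [a, b, c, d]"

text \<open>The disjuncts are the seven partitions of 5, in the order 5, 4+1, 3+2, 3+1+1, 2+2+1,
  2+1+1+1, 1+1+1+1+1. Equal values stand together, larger blocks first.\<close>

definition pattern5 :: "'a \<Rightarrow> 'a \<Rightarrow> 'a \<Rightarrow> 'a \<Rightarrow> 'a \<Rightarrow> bool" where
  "pattern5 a b c d e \<longleftrightarrow> (a = b \<and> b = c \<and> c = d \<and> d = e) \<or> (a = b \<and> b = c \<and> c = d \<and> d \<noteq> e) \<or>
    (a = b \<and> b = c \<and> d = e \<and> c \<noteq> d) \<or> (a = b \<and> b = c \<and> distinct [c, d, e]) \<or>
    (a = b \<and> c = d \<and> distinct [b, c, e]) \<or> (a = b \<and> distinct [b, c, d, e]) \<or> distinct [a, b, c, d, e]"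

lemma pattern4_insert: "pattern3 a b c \<Longrightarrow> pattern4 a b c e \<or> pattern4 e a b c \<or>
      pattern4 e b a c \<or> pattern4 e c a b"
  unfolding pattern3_def pattern4_def
  by (cases "e = a"; cases "e = b"; cases "e = c"; elim disjE conjE; simp; blast)

text \<open>One step of an insertion sort: the new value joins a block or forms its own, and the
  disjuncts list rearrangements that restore decreasing block sizes.\<close>

lemma pattern5_insert: "pattern4 a b c d \<Longrightarrow> pattern5 a b c d e \<or> pattern5 e a b c d \<or>
      pattern5 e c d a b \<or> pattern5 a b e c d \<or> pattern5 a b e d c \<or> pattern5 e b a c d \<or>
      pattern5 e c a b d \<or> pattern5 e d a b c"
  unfolding pattern4_def pattern5_def
  by (cases "e = a"; cases "e = b"; cases "e = c"; cases "e = d"; elim disjE conjE; simp; blast)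

lemma enum5_exists: "\<exists>i j k l m. enum5 i j k l m"
proof -
  have "card ({1..5} :: 6 set) = 5" by (simp add: index_set card_Diff_subset)
  then have "card ({1..5} :: 6 set) = Suc (Suc (Suc (Suc (Suc 0))))" by simp
  then obtain i j k l m where "{1..5} = {i, j, k, l, m :: 6}" "distinct [i, j, k, l, m]"
    unfolding card_Suc_eq by (auto; blast)
  then show ?thesis unfolding enum5_def by blast
qed

lemma pattern3_exists: "\<exists>i j k l m. enum5 i j k l m \<and> pattern3 (h i) (h j) (h k)"
proof -
  obtain i j k l m where e: "enum5 i j k l m" using enum5_exists by blast
  then have "enum5 k i j l m" "enum5 k j i l m" "enum5 i j k l m" by (auto simp: enum5_def)
  moreover have "pattern3 (h i) (h j) (h k) \<or> pattern3 (h k) (h i) (h j) \<or> pattern3 (h k) (h j) (h i)"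
    unfolding pattern3_def by auto
  ultimately show ?thesis by blast
qed

lemma pattern4_exists: "\<exists>i j k l m. enum5 i j k l m \<and> pattern4 (h i) (h j) (h k) (h l)"
proof -
  obtain i j k l m where e: "enum5 i j k l m" and p: "pattern3 (h i) (h j) (h k)"
    using pattern3_exists by blast
  then have "enum5 i j k l m" "enum5 l i j k m" "enum5 l j i k m" "enum5 l k i j m" by (auto simp: enum5_def)
  moreover have "pattern4 (h i) (h j) (h k) (h l) \<or> pattern4 (h l) (h i) (h j) (h k) \<or>
      pattern4 (h l) (h j) (h i) (h k) \<or> pattern4 (h l) (h k) (h i) (h j)"
    using p by (rule pattern4_insert)
  ultimately show ?thesis by blast
qed

text \<open>Reduces any labelling of the five indices to seven cases. It serves both for the
  coordinates of a singular point and for the coefficients of a hyperplane.\<close>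

lemma pattern5_exists: "\<exists>i j k l m. enum5 i j k l m \<and> pattern5 (h i) (h j) (h k) (h l) (h m)"
proof -
  obtain i j k l m where e: "enum5 i j k l m" and p: "pattern4 (h i) (h j) (h k) (h l)"
    using pattern4_exists by blast
  then have "enum5 i j k l m" "enum5 m i j k l" "enum5 m k l i j" "enum5 i j m k l" "enum5 i j m l k"
    "enum5 m j i k l" "enum5 m k i j l" "enum5 m l i j k" by (auto simp: enum5_def)
  moreover have "pattern5 (h i) (h j) (h k) (h l) (h m) \<or> pattern5 (h m) (h i) (h j) (h k) (h l) \<or>
      pattern5 (h m) (h k) (h l) (h i) (h j) \<or> pattern5 (h i) (h j) (h m) (h k) (h l) \<or>
      pattern5 (h i) (h j) (h m) (h l) (h k) \<or> pattern5 (h m) (h j) (h i) (h k) (h l) \<or>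
      pattern5 (h m) (h k) (h i) (h j) (h l) \<or> pattern5 (h m) (h l) (h i) (h j) (h k)"
    using p by (rule pattern5_insert)
  ultimately show ?thesis by blast
qed

text \<open>The equations of \<open>singular_at_X_form\<close> for six free numbers, so that equal
  coordinates can be substituted. The zero solution is still allowed here.\<close>

definition critical :: "complex \<Rightarrow> complex \<Rightarrow> complex \<Rightarrow> complex \<Rightarrow> complex \<Rightarrow> complex \<Rightarrow> complex \<Rightarrow> bool" where
  "critical \<eta> a p q r s t \<longleftrightarrow> p + q + r + s + t = \<eta> * a \<and>
    (let g = agrad a p q r s t in
      g + \<eta> * ugrad a q r s t = 0 \<and> g + \<eta> * ugrad a p r s t = 0 \<and> g + \<eta> * ugrad a p q s t = 0 \<and>
      g + \<eta> * ugrad a p q r t = 0 \<and> g + \<eta> * ugrad a p q r s = 0)"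

text \<open>The partial derivatives in two u-coordinates p and q differ by (q - p) times their mixed
  second derivative.\<close>

lemma critical_pair:
  assumes "\<eta> \<noteq> 0" "g + \<eta> * ugrad a q r s t = 0" "g + \<eta> * ugrad a p r s t = 0" "p \<noteq> q"
  shows "qcoef a r s t = 0"
proof -
  have "\<eta> * ((q - p) * qcoef a r s t) = 0"
    using assms(2,3) unfolding ugrad_def qcoef_def by algebra
  then show ?thesis using assms by simp
qed

lemma ugrad_commute:
  "ugrad a p q r s = ugrad a q p r s" "ugrad a p q r s = ugrad a p r q s" "ugrad a p q r s = ugrad a p q s r"
  unfolding ugrad_def by (simp_all add: algebra_simps)

lemma critical_pairs:
  assumes "critical \<eta> a p q r s t" "\<eta> \<noteq> 0"
  shows "p \<noteq> q \<Longrightarrow> qcoef a r s t = 0" "p \<noteq> r \<Longrightarrow> qcoef a q s t = 0" "p \<noteq> s \<Longrightarrow> qcoef a q r t = 0"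
    "p \<noteq> t \<Longrightarrow> qcoef a q r s = 0" "q \<noteq> r \<Longrightarrow> qcoef a p s t = 0" "q \<noteq> s \<Longrightarrow> qcoef a p r t = 0"
    "q \<noteq> t \<Longrightarrow> qcoef a p r s = 0" "r \<noteq> s \<Longrightarrow> qcoef a p q t = 0" "r \<noteq> t \<Longrightarrow> qcoef a p q s = 0"
    "s \<noteq> t \<Longrightarrow> qcoef a p q r = 0"
proof -
  let ?g = "agrad a p q r s t"
  have c: "?g + \<eta> * ugrad a q r s t = 0" "?g + \<eta> * ugrad a p r s t = 0" "?g + \<eta> * ugrad a p q s t = 0"
    "?g + \<eta> * ugrad a p q r t = 0" "?g + \<eta> * ugrad a p q r s = 0"
    using assms(1) by (simp_all add: critical_def Let_def)
  note pair = critical_pair[OF assms(2), of ?g]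
  show "p \<noteq> q \<Longrightarrow> qcoef a r s t = 0" using c(1,2) by (rule pair)
  show "p \<noteq> r \<Longrightarrow> qcoef a q s t = 0" using c(1,3) pair[of a r q s t p] by (simp add: ugrad_commute)
  show "p \<noteq> s \<Longrightarrow> qcoef a q r t = 0" using c(1,4) pair[of a s q r t p] by (simp add: ugrad_commute)
  show "p \<noteq> t \<Longrightarrow> qcoef a q r s = 0" using c(1,5) pair[of a t q r s p] by (simp add: ugrad_commute)
  show "q \<noteq> r \<Longrightarrow> qcoef a p s t = 0" using c(2,3) pair[of a r p s t q] by (simp add: ugrad_commute)
  show "q \<noteq> s \<Longrightarrow> qcoef a p r t = 0" using c(2,4) pair[of a s p r t q] by (simp add: ugrad_commute)
  show "q \<noteq> t \<Longrightarrow> qcoef a p r s = 0" using c(2,5) pair[of a t p r s q] by (simp add: ugrad_commute)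
  show "r \<noteq> s \<Longrightarrow> qcoef a p q t = 0" using c(3,4) pair[of a s p q t r] by (simp add: ugrad_commute)
  show "r \<noteq> t \<Longrightarrow> qcoef a p q s = 0" using c(3,5) pair[of a t p q s r] by (simp add: ugrad_commute)
  show "s \<noteq> t \<Longrightarrow> qcoef a p q r = 0" using c(4,5) pair[of a t p q r s] by (simp add: ugrad_commute)
qed

section \<open>Singular points for each coincidence pattern\<close>

context
  fixes \<eta> :: complex
  assumes \<eta>: "\<eta>\<^sup>2 = -3"
begin

lemma eta_nonzero: "\<eta> \<noteq> 0"
  using \<eta> by auto

lemma critical_5:
  assumes "critical \<eta> a x x x x x"
  shows "a = 0 \<and> x = 0"
proof -
  have e: "\<eta> * \<eta> = -3" using \<eta> by (simp add: power2_eq_square)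
  have s: "5 * x = \<eta> * a" and c: "agrad a x x x x x + \<eta> * ugrad a x x x x = 0"
    using assms by (simp_all add: critical_def Let_def)
  have a: "3 * a = - 5 * \<eta> * x" using s e by algebra
  \<comment> \<open>Eliminating a through 3 a = -5 \<eta> x turns the gradient equation into a
    nonzero multiple of \<eta> x^3.\<close>
  have "\<eta> * (x * x * x) = 0"
    using c a e unfolding agrad_def ugrad_def power2_eq_square power3_eq_cube by algebra
  then have "x = 0" using eta_nonzero by simp
  then show ?thesis using a by simp
qed

text \<open>Since \<eta>^2 = -3, the condition a^2 + 3 x^2 = 0 factors as (\<eta> a - 3 x)(\<eta> a
  + 3 x) = 0. The first factor gives the nodes E; the second leads to y = -7 x and is excluded by
  the gradient equation.\<close>

lemma critical_41:
  assumes c: "critical \<eta> a x x x x y" and "x \<noteq> y"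
  shows "y = - x \<and> 3 * x = \<eta> * a"
proof -
  have e: "\<eta> * \<eta> = -3" using \<eta> by (simp add: power2_eq_square)
  have s: "4 * x + y = \<eta> * a" and g: "agrad a x x x x y + \<eta> * ugrad a x x x x = 0"
    using c by (simp_all add: critical_def Let_def)
  have q: "a * a + 3 * (x * x) = 0"
    using critical_pairs(4)[OF c eta_nonzero \<open>x \<noteq> y\<close>] by (simp add: qcoef_def power2_eq_square algebra_simps)
  have "(\<eta> * a - 3 * x) * (\<eta> * a + 3 * x) = 0" using q e by algebra
  moreover have "\<eta> * a + 3 * x \<noteq> 0"
  proof
    assume h: "\<eta> * a + 3 * x = 0"
    then have "a = \<eta> * x" "y = - 7 * x" using e s by algebra+
    then have "\<eta> * (x * x * x) = 0"
      using g e unfolding agrad_def ugrad_def power2_eq_square power3_eq_cube by algebra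
    then show False using eta_nonzero \<open>y = - 7 * x\<close> \<open>x \<noteq> y\<close> by simp
  qed
  ultimately have "\<eta> * a = 3 * x" by simp
  then show ?thesis using s by (simp add: algebra_simps eq_neg_iff_add_eq_0)
qed

lemma critical_32:
  assumes c: "critical \<eta> a x x x y y"
  shows "x = y"
proof (rule ccontr)
  assume "x \<noteq> y"
  have e: "\<eta> * \<eta> = -3" using \<eta> by (simp add: power2_eq_square)
  have s: "3 * x + 2 * y = \<eta> * a" and g: "agrad a x x x y y + \<eta> * ugrad a x x y y = 0"
    using c by (simp_all add: critical_def Let_def algebra_simps)
  have q: "a * a + x * x + 2 * x * y = 0"
    using critical_pairs(3)[OF c eta_nonzero \<open>x \<noteq> y\<close>] by (simp add: qcoef_def power2_eq_square algebra_simps)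
  have r: "3 * x * x + 3 * x * y + 2 * y * y = 0" using q s e by algebra
  \<comment> \<open>Modulo \<open>q\<close> the a-derivative is 2 a (x + y)^2 and the u-derivative
    is -2 x (x + y)^2. Their combination, multiplied by \<eta>, is a multiple of this cubic because
    \<eta> a = 3 x + 2 y. Either linear factor together with \<open>r\<close> forces x = y =
    0.\<close>
  have "(x + y) * (x + y) * (3 * x + y) = 0"
    using g q s e unfolding agrad_def ugrad_def power2_eq_square power3_eq_cube by algebra
  then have "y = - x \<or> y = - 3 * x" by (auto simp: add_eq_0_iff)
  then have "x = 0 \<and> y = 0" using r by auto
  then show False using \<open>x \<noteq> y\<close> by simp
qed

text \<open>The two mixed conditions that omit y and z respectively differ by 2 x (z - y). This
  forces x = 0 and then a = 0, giving the nodes T.\<close>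

lemma critical_311:
  assumes c: "critical \<eta> a x x x y z" and "distinct [x, y, z]"
  shows "a = 0 \<and> x = 0 \<and> z = - y"
proof -
  have s: "3 * x + y + z = \<eta> * a" using c by (simp add: critical_def)
  have "a * a + x * x + 2 * x * z = 0" "a * a + x * x + 2 * x * y = 0"
    using critical_pairs(3,4)[OF c eta_nonzero] assms(2) by (simp_all add: qcoef_def power2_eq_square algebra_simps)
  moreover from this have "x * (z - y) = 0" by algebra
  ultimately have "x = 0" "a = 0" using assms(2) by auto
  then show ?thesis using s by (simp add: add_eq_0_iff)
qed

text \<open>The two mixed conditions differ by y^2 - x^2, hence y = -x and then a^2 = x^2, giving
  the nodes R.\<close>

lemma critical_221:
  assumes c: "critical \<eta> a x x y y z" and "distinct [x, y, z]"
  shows "a \<noteq> 0 \<and> (x = a \<or> x = - a) \<and> y = - x \<and> z = \<eta> * a"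
proof -
  have s: "2 * x + 2 * y + z = \<eta> * a" using c by (simp add: critical_def algebra_simps)
  have q: "a * a + 2 * x * y + y * y = 0" "a * a + 2 * x * y + x * x = 0"
    using critical_pairs(7,10)[OF c eta_nonzero] assms(2) by (simp_all add: qcoef_def power2_eq_square algebra_simps)
  then have "(x - y) * (x + y) = 0" by algebra
  then have y: "y = - x" using assms(2) by (auto simp: add_eq_0_iff)
  then have "(x - a) * (x + a) = 0" using q by algebra
  then have x: "x = a \<or> x = - a" by (auto simp: add_eq_0_iff)
  then show ?thesis using y s assms(2) by auto
qed

text \<open>Differences of the mixed conditions force two distinct values to be the negative of one
  and the same value. The argument for \<open>critical_11111\<close> is the same.\<close>

lemma critical_2111:
  assumes c: "critical \<eta> a x x y z w"
  shows "\<not> distinct [x, y, z, w]"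
proof
  assume d: "distinct [x, y, z, w]"
  then have q: "qcoef a x z w = 0" "qcoef a x y w = 0" "qcoef a x y z = 0"
    using critical_pairs(2-4)[OF c eta_nonzero] by auto
  have "(z - y) * (x + w) = 0" "(w - y) * (x + z) = 0" using q unfolding qcoef_def by algebra+
  then show False using d by (auto simp: add_eq_0_iff)
qed

lemma critical_11111:
  assumes c: "critical \<eta> a p q r s t"
  shows "\<not> distinct [p, q, r, s, t]"
proof
  assume d: "distinct [p, q, r, s, t]"
  then have q: "qcoef a r s t = 0" "qcoef a q s t = 0" "qcoef a q r t = 0"
    using critical_pairs(1-3)[OF c eta_nonzero] by auto
  have "(r - q) * (s + t) = 0" "(s - q) * (r + t) = 0" using q unfolding qcoef_def by algebra+
  then have "s = - t" "r = - t" using d by (auto simp: add_eq_0_iff2)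
  then show False using d by simp
qed

end

section \<open>The forty-five node vectors\<close>

definition pairs :: "'a set \<Rightarrow> 'a set set" where
  "pairs I = {A. A \<subseteq> I \<and> card A = 2}"

lemma pairs_iff: "A \<in> pairs I \<longleftrightarrow> (\<exists>p q. A = {p, q} \<and> p \<noteq> q \<and> p \<in> I \<and> q \<in> I)"
  unfolding pairs_def card_2_iff by auto

lemma finite_pairs: "finite I \<Longrightarrow> finite (pairs I)"
  unfolding pairs_def by simp

text \<open>A node is a line, so either sign represents it; \<open>Min\<close> and
  \<open>Max\<close> make the representative a function of the unordered pair.\<close>

definition T_vec :: "6 set \<Rightarrow> complex ^ 6" where
  "T_vec C = axis (Min C) 1 - axis (Max C) 1"

definition E_vec :: "complex \<Rightarrow> 6 \<Rightarrow> complex ^ 6" where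
  "E_vec \<eta> c = (\<chi> n. if n = 0 then 1 else if n = c then - (\<eta> / 3) else \<eta> / 3)"

text \<open>The node R_{A,B;c}, where B is the complement of A among the indices other than c.
  Interchanging A and B gives a different node, so each c contributes six.\<close>

definition R_vec :: "complex \<Rightarrow> 6 \<Rightarrow> 6 set \<Rightarrow> complex ^ 6" where
  "R_vec \<eta> c A = (\<chi> n. if n = 0 then 1 else if n = c then \<eta> else if n \<in> A then -1 else 1)"

definition R_index :: "(6 \<times> 6 set) set" where
  "R_index = (SIGMA c:{1..5}. pairs ({1..5} - {c}))"

definition node_vecs :: "complex \<Rightarrow> (complex ^ 6) set" where
  "node_vecs \<eta> = T_vec ` pairs {1..5} \<union> E_vec \<eta> ` {1..5} \<union> case_prod (R_vec \<eta>) ` R_index"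

lemma T_vec_cases:
  "T_vec {p, q} = axis p 1 - axis q 1 \<or> T_vec {p, q} = axis q 1 - axis p 1"
  unfolding T_vec_def by (cases p q rule: linorder_cases) auto

lemma E_vec_enum:
  assumes "enum5 i j k l m"
  shows "E_vec \<eta> m $ 0 = 1" "E_vec \<eta> m $ i = \<eta> / 3" "E_vec \<eta> m $ j = \<eta> / 3" "E_vec \<eta> m $ k = \<eta> / 3"
    "E_vec \<eta> m $ l = \<eta> / 3" "E_vec \<eta> m $ m = - (\<eta> / 3)"
  using assms enum5_nonzero[OF assms] by (auto simp: E_vec_def enum5_def)

lemma R_vec_enum:
  assumes "enum5 i j k l m"
  shows "R_vec \<eta> m {i, j} $ 0 = 1" "R_vec \<eta> m {i, j} $ i = -1" "R_vec \<eta> m {i, j} $ j = -1"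
    "R_vec \<eta> m {i, j} $ k = 1" "R_vec \<eta> m {i, j} $ l = 1" "R_vec \<eta> m {i, j} $ m = \<eta>"
  using assms enum5_nonzero[OF assms] by (auto simp: R_vec_def enum5_def)

lemma axis_diff_enum:
  assumes "enum5 i j k l m"
  shows "(axis i 1 - axis j 1) $ 0 = (0 :: complex)" "(axis i 1 - axis j 1) $ i = (1 :: complex)"
    "(axis i 1 - axis j 1) $ j = (-1 :: complex)" "(axis i 1 - axis j 1) $ k = (0 :: complex)"
    "(axis i 1 - axis j 1) $ l = (0 :: complex)" "(axis i 1 - axis j 1) $ m = (0 :: complex)"
  using assms enum5_nonzero[OF assms] by (auto simp: axis_def enum5_def)

lemma card_indices: "card ({1..5} :: 6 set) = 5"
  by (simp add: index_set card_Diff_subset)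

lemma enum5_extend2:
  assumes "p \<noteq> q" "p \<in> {1..5}" "q \<in> {1..5}"
  shows "\<exists>k l m. enum5 p q k l m"
proof -
  have "card ({1..5} - {p, q}) = 3" using assms by (simp add: card_Diff_subset card_indices)
  then obtain k l m where s: "{1..5} - {p, q} = {k, l, m}" and d: "distinct [k, l, m]"
    by (auto simp: card_3_iff)
  have "{1..5} = {p, q} \<union> ({1..5} - {p, q})" using assms by auto
  then have "{1..5} = {p, q, k, l, m}" unfolding s by (simp only: Un_insert_left Un_empty_left)
  moreover have "p \<notin> {k, l, m}" "q \<notin> {k, l, m}" unfolding s[symmetric] by auto
  ultimately have "enum5 p q k l m" using d \<open>p \<noteq> q\<close> unfolding enum5_def by simp
  then show ?thesis by blast
qed

lemma enum5_extend1:
  assumes "c \<in> {1..5}"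
  shows "\<exists>i j k l. enum5 i j k l c"
proof -
  have "\<exists>q\<in>{1..5}. q \<noteq> c"
  proof (rule ccontr)
    assume "\<not> ?thesis"
    then have "{1..5} \<subseteq> {c}" by auto
    then have "card ({1..5} :: 6 set) \<le> 1" by (metis card.empty card_mono card_insert_le_m1 finite.emptyI finite_insert One_nat_def is_singletonI is_singleton_altdef)
    then show False by (simp add: card_indices)
  qed
  then obtain q where "q \<in> {1..5}" "q \<noteq> c" by blast
  then obtain k l m where "enum5 c q k l m" using enum5_extend2 assms by metis
  then have "enum5 q k l m c" unfolding enum5_def by auto
  then show ?thesis by blast
qed

lemma enum5_extend3:
  assumes "(c, A) \<in> R_index"
  shows "\<exists>i j k l. A = {i, j} \<and> enum5 i j k l c"
proof -
  obtain i j where ij: "A = {i, j}" "i \<noteq> j" "i \<in> {1..5} - {c}" "j \<in> {1..5} - {c}" and c: "c \<in> {1..5}"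
    using assms unfolding R_index_def by (auto simp: pairs_iff)
  then obtain k l m where e: "enum5 i j k l m" using enum5_extend2[of i j] by auto
  then have "c = k \<or> c = l \<or> c = m" using c ij unfolding enum5_def by auto
  then have "enum5 i j l m c \<or> enum5 i j k m c \<or> enum5 i j k l c" using e unfolding enum5_def by auto
  then show ?thesis using ij by blast
qed

lemma enum5_members:
  assumes "enum5 i j k l m"
  shows "{i, j} \<in> pairs {1..5}" "m \<in> {1..5}" "(m, {i, j}) \<in> R_index"
  using assms unfolding enum5_def R_index_def by (auto simp: pairs_iff)

lemma critical_iff_singular:
  assumes "enum5 i j k l m" "\<eta> \<noteq> 0"
  shows "singular_at (L_space \<eta>) X_form x \<longleftrightarrow>
    x \<noteq> 0 \<and> critical \<eta> (x$0) (x$i) (x$j) (x$k) (x$l) (x$m)"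
  unfolding singular_at_X_form[OF assms] L_space_enum[OF assms(1)] critical_def Let_def by blast

lemma span_scaled:
  fixes y :: "complex ^ 'n"
  assumes "c \<noteq> 0"
  shows "vec.span {c *s y} = vec.span {y}"
proof -
  have "c *s y \<in> vec.span {y}" "(1 / c) *s (c *s y) \<in> vec.span {c *s y}"
    by (intro vec.span_scale vec.span_base; simp)+
  then show ?thesis using assms by (intro subset_antisym vec.span_minimal) auto
qed

context
  fixes \<eta> :: complex
  assumes \<eta>: "\<eta>\<^sup>2 = -3"
begin

lemma node_vecs_node:
  assumes "y \<in> node_vecs \<eta>"
  shows "node_at (L_space \<eta>) X_form y"
proof -
  consider p q where "y = T_vec {p, q}" "p \<noteq> q" "p \<in> {1..5}" "q \<in> {1..5}"
    | c where "y = E_vec \<eta> c" "c \<in> {1..5}"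
    | c A where "y = R_vec \<eta> c A" "(c, A) \<in> R_index"
    using assms unfolding node_vecs_def by (auto simp: pairs_iff)
  then show ?thesis
  proof cases
    case 1
    then obtain k l m where e: "enum5 p q k l m" using enum5_extend2 by blast
    \<comment> \<open>The sign of \<open>T_vec {p, q}\<close> depends on the order of p and q, so
      both orientations are covered.\<close>
    then have e': "enum5 q p k l m" by (rule enum5_swap)
    show ?thesis
      using T_vec_cases[of p q] node_T[OF e eta_nonzero[OF \<eta>]] node_T[OF e' eta_nonzero[OF \<eta>]]
        axis_diff_enum[OF e] axis_diff_enum[OF e'] 1(1) by metis
  next
    case 2
    then obtain i j k l where e: "enum5 i j k l c" using enum5_extend1 by blast
    show ?thesis unfolding 2(1) by (rule node_E[OF e \<eta>]) (simp_all add: E_vec_enum[OF e])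
  next
    case 3
    then obtain i j k l where e: "enum5 i j k l c" and A: "A = {i, j}" using enum5_extend3 by blast
    show ?thesis unfolding 3(1) A by (rule node_R[OF e \<eta>]) (simp_all add: R_vec_enum[OF e])
  qed
qed

text \<open>The patterns 4+1, 3+1+1 and 2+2+1 give E, T and R; the others are impossible for a
  nonzero vector. The scale is the coordinate a for E and R, and a nonzero u-coordinate for T, where
  a = 0.\<close>

lemma singular_is_node_vec:
  assumes s: "singular_at (L_space \<eta>) X_form x"
  shows "\<exists>c y. y \<in> node_vecs \<eta> \<and> c \<noteq> 0 \<and> x = c *s y"
proof -
  obtain i j k l m where e: "enum5 i j k l m" and p: "pattern5 (x$i) (x$j) (x$k) (x$l) (x$m)"
    using pattern5_exists[of "($) x"] by blast
  have x0: "x \<noteq> 0" and c: "critical \<eta> (x$0) (x$i) (x$j) (x$k) (x$l) (x$m)"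
    using s critical_iff_singular[OF e eta_nonzero[OF \<eta>]] by auto
  note zero = vec_eq_enum[OF e, of x 0]
  consider "x$i = x$j" "x$j = x$k" "x$k = x$l" "x$l = x$m"
    | "x$i = x$j" "x$j = x$k" "x$k = x$l" "x$l \<noteq> x$m"
    | "x$i = x$j" "x$j = x$k" "x$l = x$m" "x$k \<noteq> x$l"
    | "x$i = x$j" "x$j = x$k" "distinct [x$k, x$l, x$m]"
    | "x$i = x$j" "x$k = x$l" "distinct [x$j, x$k, x$m]"
    | "x$i = x$j" "distinct [x$j, x$k, x$l, x$m]"
    | "distinct [x$i, x$j, x$k, x$l, x$m]"
    using p unfolding pattern5_def by argo
  then show ?thesis
  proof cases
    case 1
    then show ?thesis using critical_5[OF \<eta>, of "x$0" "x$m"] c x0 zero by simp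
  next
    case 2
    then have *: "x$m = - x$l" "3 * x$l = \<eta> * x$0" using critical_41[OF \<eta>, of "x$0" "x$l" "x$m"] c by simp_all
    have "x$0 \<noteq> 0" using * 2 by auto
    moreover have "x = x$0 *s E_vec \<eta> m"
      using * 2 by (simp add: vec_eq_enum[OF e] E_vec_enum[OF e]) (simp add: field_simps)
    moreover have "E_vec \<eta> m \<in> node_vecs \<eta>" using enum5_members[OF e] by (auto simp: node_vecs_def)
    ultimately show ?thesis by blast
  next
    case 3
    then show ?thesis using critical_32[OF \<eta>, of "x$0" "x$k" "x$m"] c by simp
  next
    case 4
    then have *: "x$0 = 0" "x$k = 0" "x$m = - x$l" using critical_311[OF \<eta>, of "x$0" "x$k" "x$l" "x$m"] c by simp_all
    have e': "enum5 l m i j k" "enum5 m l i j k" using e unfolding enum5_def by auto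
    have "x = x$l *s (axis l 1 - axis m 1)" "x = x$m *s (axis m 1 - axis l 1)"
      using * 4 e enum5_nonzero[OF e] by (auto simp: vec_eq_enum[OF e'(1)] axis_def enum5_def)
    moreover have "x$l \<noteq> 0" "x$m \<noteq> 0" using * 4 by auto
    moreover have "T_vec {l, m} \<in> node_vecs \<eta>" using enum5_members(1)[OF e'(1)] by (auto simp: node_vecs_def)
    ultimately show ?thesis using T_vec_cases[of l m] by metis
  next
    case 5
    then have *: "x$0 \<noteq> 0" "x$i = x$0 \<or> x$i = - x$0" "x$k = - x$i" "x$m = \<eta> * x$0"
      using critical_221[OF \<eta>, of "x$0" "x$i" "x$k" "x$m"] c by auto
    have e': "enum5 k l i j m" using e unfolding enum5_def by auto
    \<comment> \<open>A is the pair on which u = -a: it is {k, l} if u_i = a and {i, j}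
      otherwise.\<close>
    have "x = x$0 *s R_vec \<eta> m {k, l} \<or> x = x$0 *s R_vec \<eta> m {i, j}"
      using * 5 by (auto simp: vec_eq_enum[OF e] R_vec_enum[OF e] R_vec_enum[OF e'])
    moreover have "R_vec \<eta> m {i, j} \<in> node_vecs \<eta>" "R_vec \<eta> m {k, l} \<in> node_vecs \<eta>"
      using enum5_members(3)[OF e] enum5_members(3)[OF e'] by (force simp: node_vecs_def)+
    ultimately show ?thesis using *(1) by blast
  next
    case 6
    then show ?thesis using critical_2111[OF \<eta>, of "x$0" "x$j" "x$k" "x$l" "x$m"] c by simp
  next
    case 7
    then show ?thesis using critical_11111[OF \<eta>] c by blast
  qed
qed

text \<open>Nodes are singular points, hence multiples of listed vectors; conversely each listed
  vector has been shown to be a node.\<close>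

lemma nodes_eq: "nodes (L_space \<eta>) X_form = (\<lambda>y. vec.span {y}) ` node_vecs \<eta>"
proof (intro equalityI subsetI)
  fix P assume "P \<in> nodes (L_space \<eta>) X_form"
  then obtain x where P: "P = vec.span {x}" and x: "singular_at (L_space \<eta>) X_form x"
    unfolding nodes_def node_at_def by auto
  then obtain c y where y: "y \<in> node_vecs \<eta>" and c: "c \<noteq> 0" "x = c *s y"
    using singular_is_node_vec by blast
  have "P = vec.span {y}" unfolding P c(2) by (rule span_scaled) (rule c(1))
  then show "P \<in> (\<lambda>y. vec.span {y}) ` node_vecs \<eta>" using y by blast
next
  fix P assume "P \<in> (\<lambda>y. vec.span {y}) ` node_vecs \<eta>"
  then show "P \<in> nodes (L_space \<eta>) X_form" unfolding nodes_def using node_vecs_node by auto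
qed

section \<open>Counting the nodes in a subspace\<close>

lemma T_vec_support: "C \<in> pairs {1..5} \<Longrightarrow> {n. T_vec C $ n \<noteq> 0} = C"
proof -
  assume "C \<in> pairs {1..5}"
  then obtain p q where "C = {p, q}" "p \<noteq> q" by (auto simp: pairs_iff)
  then show ?thesis using T_vec_cases[of p q] by (auto simp: axis_def)
qed

lemma T_vec_0: "C \<in> pairs {1..5} \<Longrightarrow> T_vec C $ 0 = 0"
  using T_vec_support[of C] by (auto simp: pairs_def index_set)

lemma inj_T_vec: "inj_on T_vec (pairs {1..5})"
  by (rule inj_on_inverseI[where g = "\<lambda>v. {n. v $ n \<noteq> 0}"]) (rule T_vec_support)

lemma inj_E_vec: "inj_on (E_vec \<eta>) {1..5}"
proof (rule inj_onI)
  fix c d :: 6 assume c: "c \<in> {1..5}" and "E_vec \<eta> c = E_vec \<eta> d"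
  then have "E_vec \<eta> c $ c = E_vec \<eta> d $ c" by simp
  then show "c = d" using c eta_nonzero[OF \<eta>] by (auto simp: E_vec_def index_set split: if_splits)
qed

lemma eta_distinct: "\<eta> \<noteq> 1" "\<eta> \<noteq> -1" "\<eta> \<noteq> 3" "\<eta> \<noteq> -3"
  using \<eta> by auto

text \<open>The entries \<eta> and -1 mark c and A, since \<eta> differs from 1 and -1. Reading them
  off yields an inverse of \<open>R_vec\<close>.\<close>

lemma R_vec_support:
  assumes "(c, A) \<in> R_index"
  shows "{n. n \<noteq> 0 \<and> R_vec \<eta> c A $ n = \<eta>} = {c}" "{n. n \<noteq> 0 \<and> R_vec \<eta> c A $ n = -1} = A"
  using assms eta_distinct unfolding R_index_def pairs_def by (auto simp: R_vec_def index_set split: if_splits)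

lemma inj_R_vec: "inj_on (case_prod (R_vec \<eta>)) R_index"
  by (rule inj_on_inverseI[where g = "\<lambda>v. (the_elem {n. n \<noteq> 0 \<and> v $ n = \<eta>}, {n. n \<noteq> 0 \<and> v $ n = -1})"])
    (clarsimp simp: R_vec_support)

lemma E_vec_R_vec_disjoint: "E_vec \<eta> ` {1..5} \<inter> case_prod (R_vec \<eta>) ` R_index = {}"
proof -
  have "E_vec \<eta> c \<noteq> R_vec \<eta> d A" if r: "(d, A) \<in> R_index" for c d A
  proof
    assume h: "E_vec \<eta> c = R_vec \<eta> d A"
    \<comment> \<open>At an index of A the entry of R is -1, whereas that of E is \<eta>/3 or
      -\<eta>/3, and \<eta> is neither 3 nor -3.\<close>
    obtain i where i: "i \<in> A" "i \<noteq> 0" "i \<noteq> d" using r unfolding R_index_def by (auto simp: pairs_iff index_set)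
    have "E_vec \<eta> c $ i = R_vec \<eta> d A $ i" using h by simp
    then show False using i eta_distinct by (auto simp: E_vec_def R_vec_def field_simps split: if_splits)
  qed
  then show ?thesis by auto
qed

lemma node_vecs_coord0: "y \<in> node_vecs \<eta> \<Longrightarrow> y $ 0 = 1 \<or> y \<in> T_vec ` pairs {1..5} \<and> y $ 0 = 0"
  unfolding node_vecs_def using T_vec_0 by (auto simp: E_vec_def R_vec_def)

text \<open>The representatives are normalised: one with a = 1 is determined by its line, and a
  vector T is determined by its support, which scaling preserves.\<close>

lemma inj_node_span: "inj_on (\<lambda>y. vec.span {y}) (node_vecs \<eta>)"
proof (rule inj_onI)
  fix y z assume y: "y \<in> node_vecs \<eta>" and z: "z \<in> node_vecs \<eta>" and s: "vec.span {y} = vec.span {z}"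
  have nz: "y \<noteq> 0" using node_vecs_node[OF y] by (simp add: node_at_def singular_at_def)
  have "y \<in> vec.span {z}" using s by (metis insertI1 vec.span_base)
  then obtain k where k: "y = k *s z" by (auto simp: vec.span_singleton)
  then have "k \<noteq> 0" using nz by auto
  consider "y$0 = 1" "z$0 = 1" | C D where "y = T_vec C" "z = T_vec D" "C \<in> pairs {1..5}" "D \<in> pairs {1..5}"
    using node_vecs_coord0[OF y] node_vecs_coord0[OF z] k \<open>k \<noteq> 0\<close> by auto
  then show "y = z"
  proof cases
    case 1
    then show ?thesis using k by simp
  next
    case 2
    have "{n. y $ n \<noteq> 0} = {n. z $ n \<noteq> 0}" using k \<open>k \<noteq> 0\<close> by simp
    then show ?thesis using 2 T_vec_support by simp
  qed
qed

text \<open>A subspace contains a line as soon as it contains a spanning vector. Counting lines thus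
  becomes counting vectors in three disjoint families.\<close>

lemma card_nodes_subspace:
  assumes "vec.subspace H"
  shows "card {P \<in> nodes (L_space \<eta>) X_form. P \<subseteq> H} =
    card {C \<in> pairs {1..5}. T_vec C \<in> H} + card {c \<in> {1..5}. E_vec \<eta> c \<in> H} +
    (\<Sum>c\<in>{1..5}. card {A \<in> pairs ({1..5} - {c}). R_vec \<eta> c A \<in> H})"
proof -
  have sub: "vec.span {y} \<subseteq> H \<longleftrightarrow> y \<in> H" for y
    using vec.span_base[of y "{y}"] vec.span_minimal[of "{y}" H] assms by auto
  let ?T = "{C \<in> pairs {1..5}. T_vec C \<in> H}" and ?E = "{c \<in> {1..5}. E_vec \<eta> c \<in> H}"
  let ?R = "SIGMA c:{1..5}. {A \<in> pairs ({1..5} - {c}). R_vec \<eta> c A \<in> H}"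
  have R_sub: "?R \<subseteq> R_index" by (auto simp: R_index_def)
  have fin: "finite ?T" "finite ?E" "finite ?R" by (auto simp: finite_pairs)
  have "{P \<in> nodes (L_space \<eta>) X_form. P \<subseteq> H} = (\<lambda>y. vec.span {y}) ` {y \<in> node_vecs \<eta>. y \<in> H}"
    unfolding nodes_eq using sub by auto
  then have "card {P \<in> nodes (L_space \<eta>) X_form. P \<subseteq> H} = card {y \<in> node_vecs \<eta>. y \<in> H}"
    using card_image[OF inj_on_subset[OF inj_node_span, of "{y \<in> node_vecs \<eta>. y \<in> H}"]] by simp
  also have "{y \<in> node_vecs \<eta>. y \<in> H} = T_vec ` ?T \<union> (E_vec \<eta> ` ?E \<union> case_prod (R_vec \<eta>) ` ?R)"
    unfolding node_vecs_def R_index_def by auto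
  also have "card \<dots> = card (T_vec ` ?T) + card (E_vec \<eta> ` ?E \<union> case_prod (R_vec \<eta>) ` ?R)"
  proof (rule card_Un_disjoint)
    have "y $ 0 = 0" if "y \<in> T_vec ` ?T" for y
      using that T_vec_0 by auto
    moreover have "y $ 0 = 1" if "y \<in> E_vec \<eta> ` ?E \<union> case_prod (R_vec \<eta>) ` ?R" for y
      using that by (auto simp: E_vec_def R_vec_def)
    ultimately show "T_vec ` ?T \<inter> (E_vec \<eta> ` ?E \<union> case_prod (R_vec \<eta>) ` ?R) = {}"
      by (metis (no_types, lifting) disjoint_iff zero_neq_one)
  qed (use fin in blast)+
  also have "card (E_vec \<eta> ` ?E \<union> case_prod (R_vec \<eta>) ` ?R) = card (E_vec \<eta> ` ?E) + card (case_prod (R_vec \<eta>) ` ?R)"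
  proof (rule card_Un_disjoint)
    show "E_vec \<eta> ` ?E \<inter> case_prod (R_vec \<eta>) ` ?R = {}"
      using E_vec_R_vec_disjoint image_mono[OF R_sub, of "case_prod (R_vec \<eta>)"] by blast
  qed (use fin in blast)+
  also have "card (T_vec ` ?T) = card ?T"
    by (rule card_image) (rule inj_on_subset[OF inj_T_vec], auto)
  also have "card (E_vec \<eta> ` ?E) = card ?E"
    by (rule card_image) (rule inj_on_subset[OF inj_E_vec], auto)
  also have "card (case_prod (R_vec \<eta>) ` ?R) = card ?R"
    by (rule card_image) (rule inj_on_subset[OF inj_R_vec R_sub])
  also have "\<dots> = (\<Sum>c\<in>{1..5}. card {A \<in> pairs ({1..5} - {c}). R_vec \<eta> c A \<in> H})"
    by (rule card_SigmaI) (auto simp: finite_pairs)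
  finally show ?thesis by simp
qed

end

section \<open>Hyperplanes as kernels\<close>

definition functional :: "complex \<Rightarrow> (6 \<Rightarrow> complex) \<Rightarrow> complex ^ 6 \<Rightarrow> complex" where
  "functional \<alpha> h x = \<alpha> * x$0 + (\<Sum>i\<in>{1..5}. h i * x$i)"

text \<open>The description is redundant: (\<alpha>, h) may be scaled and shifted by multiples of
  (-\<eta>, 1, ..., 1), and a functional vanishing on L gives L itself instead of a
  hyperplane.\<close>

definition L_kernel :: "complex \<Rightarrow> complex \<Rightarrow> (6 \<Rightarrow> complex) \<Rightarrow> (complex ^ 6) set" where
  "L_kernel \<eta> \<alpha> h = {x \<in> L_space \<eta>. functional \<alpha> h x = 0}"

lemma functional_linear:
  "functional \<alpha> h (x + y) = functional \<alpha> h x + functional \<alpha> h y"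
  "functional \<alpha> h (x - y) = functional \<alpha> h x - functional \<alpha> h y"
  "functional \<alpha> h (k *s x) = k * functional \<alpha> h x"
  "functional \<alpha> h 0 = 0"
  unfolding functional_def by (simp_all add: algebra_simps sum.distrib sum_subtractf sum_distrib_left)

lemma L_subspace: "vec.subspace (L_space \<eta>)"
  unfolding vec.subspace_def L_space_def
  by (simp add: sum.distrib sum_distrib_left[symmetric] algebra_simps)

lemma L_kernel_subspace: "vec.subspace (L_kernel \<eta> \<alpha> h)"
  using L_subspace[of \<eta>] unfolding L_kernel_def vec.subspace_def
  by (simp add: functional_linear)

lemma UNIV_indices: "(UNIV :: 6 set) = insert 0 {1..5}" "(0 :: 6) \<notin> {1..5}"
  by (auto simp: index_set)

text \<open>Subtracting the right multiple of b moves any vector of L into the kernel, so b and the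
  kernel together span L.\<close>

lemma hyperplane_L_kernel:
  assumes b: "b \<in> L_space \<eta>" "b \<notin> L_kernel \<eta> \<alpha> h"
  shows "hyperplane_of (L_space \<eta>) (L_kernel \<eta> \<alpha> h)"
proof -
  let ?H = "L_kernel \<eta> \<alpha> h"
  let ?\<phi> = "functional \<alpha> h"
  have nz: "?\<phi> b \<noteq> 0" using b by (simp add: L_kernel_def)
  have "L_space \<eta> \<subseteq> vec.span (insert b ?H)"
  proof
    fix x assume x: "x \<in> L_space \<eta>"
    have "x - (?\<phi> x / ?\<phi> b) *s b \<in> L_space \<eta>"
      using x b L_subspace by (simp add: vec.subspace_diff vec.subspace_scale)
    moreover have "?\<phi> (x - (?\<phi> x / ?\<phi> b) *s b) = 0" using nz by (simp add: functional_linear)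
    ultimately have "x - (?\<phi> x / ?\<phi> b) *s b \<in> ?H" unfolding L_kernel_def by blast
    then show "x \<in> vec.span (insert b ?H)"
      by (meson vec.span_base vec.span_breakdown_eq)
  qed
  moreover have "vec.span (insert b ?H) \<subseteq> L_space \<eta>"
    using b L_subspace by (intro vec.span_minimal) (auto simp: L_kernel_def)
  ultimately have "vec.dim (L_space \<eta>) = vec.dim (insert b ?H)"
    by (metis subset_antisym vec.dim_span)
  moreover have "b \<notin> vec.span ?H"
    using b L_kernel_subspace by (metis vec.span_eq_iff)
  ultimately show ?thesis
    using L_kernel_subspace unfolding hyperplane_of_def by (auto simp: vec.dim_insert L_kernel_def)
qed

lemma hyperplane_is_L_kernel:
  assumes H: "hyperplane_of (L_space \<eta>) H"
  shows "\<exists>\<alpha> h. H = L_kernel \<eta> \<alpha> h"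
proof -
  have sub: "vec.subspace H" "H \<subseteq> L_space \<eta>" and dim: "vec.dim H + 1 = vec.dim (L_space \<eta>)"
    using H by (auto simp: hyperplane_of_def)
  obtain b where b: "b \<in> L_space \<eta>" "b \<notin> H"
    using sub dim by (metis add_cancel_left_right subsetI subset_antisym zero_neq_one)
  have span_H: "vec.span H = H" using sub by (metis vec.span_eq_iff)
  have "vec.dim (insert b H) = vec.dim (L_space \<eta>)"
    using b(2) dim vec.dim_insert[of b H] unfolding span_H by simp
  then have span: "vec.span (insert b H) = L_space \<eta>"
    using b sub L_subspace
    by (metis insert_subset order_refl vec.dim_span vec.span_minimal vec.subspace_dim_equal vec.subspace_span)
  obtain B where B: "B \<subseteq> H" "vec.independent B" "H \<subseteq> vec.span B"
    using vec.basis_exists by metis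
  have sB: "vec.span B = H" using B sub by (metis subset_antisym vec.span_minimal)
  have "vec.independent (insert b B)" using B b sB by (simp add: vec.independent_insert)
  \<comment> \<open>The map g kills a basis of H and sends b to a basis vector. Its component 0 is
    the desired functional on the whole space, with coefficients in row 0 of the matrix of
    g.\<close>
  then obtain g where g: "Vector_Spaces.linear (*s) (*s) g"
      "\<forall>x\<in>insert b B. g x = (if x = b then axis 0 1 else 0 :: complex^6)"
    using vec.linear_independent_extend[of "insert b B" "\<lambda>x. if x = b then axis 0 1 else 0"] by blast
  have "b \<notin> B" using b B by auto
  then have gB: "\<forall>x\<in>B. g x = 0" and gb: "g b = axis 0 1" using g by auto
  have gH: "g x = 0" if "x \<in> H" for x
    using that gB sB vec.linear_eq_0_on_span[OF g(1), of B x] by auto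
  define \<phi> where "\<phi> x = (g x) $ 0" for x
  have \<phi>: "\<phi> x = matrix g $ 0 $ 0 * x$0 + (\<Sum>i\<in>{1..5}. matrix g $ 0 $ i * x$i)" for x
  proof -
    have "\<phi> x = (matrix g *v x) $ 0" unfolding \<phi>_def using matrix_works[OF g(1)] by metis
    also have "\<dots> = (\<Sum>i\<in>UNIV. matrix g $ 0 $ i * x$i)" by (simp add: matrix_vector_mult_def)
    finally show ?thesis unfolding UNIV_indices(1) using UNIV_indices(2) by simp
  qed
  have "x \<in> H \<longleftrightarrow> \<phi> x = 0" if x: "x \<in> L_space \<eta>" for x
  proof -
    obtain k where k: "x - k *s b \<in> vec.span H"
      using x span by (metis vec.span_breakdown_eq)
    then have k': "x - k *s b \<in> H" using span_H by simp
    have "g x = g (x - k *s b) + k *s g b"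
      using g(1) by (simp add: Vector_Spaces.linear_iff) (metis diff_add_cancel)
    then have "\<phi> x = k" using gH[OF k'] gb by (simp add: \<phi>_def)
    moreover have "x \<in> H" if "k = 0" using k' that by simp
    moreover have "k = 0" if "x \<in> H"
      using gH[OF that] \<open>\<phi> x = k\<close> by (simp add: \<phi>_def)
    ultimately show ?thesis by blast
  qed
  then have "H = L_kernel \<eta> (matrix g $ 0 $ 0) (\<lambda>i. matrix g $ 0 $ i)"
    unfolding L_kernel_def functional_def \<phi>[symmetric] using sub by blast
  then show ?thesis by blast
qed

section \<open>Counting nodes on a hyperplane\<close>

text \<open>For v = \<alpha> + \<eta> h_c and x = h_i + h_j - h_k - h_l this counts how many of
  R_{A,B;c} and R_{B,A;c} lie on the kernel, where A = {i, j} and B = {k, l}. Both do when v = x =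
  0.\<close>

definition pm :: "complex \<Rightarrow> complex \<Rightarrow> nat" where
  "pm v x = of_bool (v = x) + of_bool (v = - x)"

text \<open>The number of nodes R with a fixed c on the kernel, summed over the three splittings of
  the other four indices into two pairs.\<close>

definition quad :: "complex \<Rightarrow> complex \<Rightarrow> complex \<Rightarrow> complex \<Rightarrow> complex \<Rightarrow> nat" where
  "quad v a b c d = pm v (a + b - c - d) + pm v (a + c - b - d) + pm v (a + d - b - c)"

text \<open>The incidence condition for E_c, multiplied by 3; \<open>s\<close> is the sum of all
  five coefficients and \<open>a\<close> is the one at c.\<close>

definition E_bit :: "complex \<Rightarrow> complex \<Rightarrow> complex \<Rightarrow> complex \<Rightarrow> nat" where
  "E_bit \<eta> \<alpha> s a = of_bool (3 * \<alpha> + \<eta> * (s - 2 * a) = 0)"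

definition node_count :: "complex \<Rightarrow> complex \<Rightarrow> complex \<Rightarrow> complex \<Rightarrow> complex \<Rightarrow> complex \<Rightarrow> complex \<Rightarrow> nat" where
  "node_count \<eta> \<alpha> a b c d e = (let s = a + b + c + d + e in
    of_bool (a = b) + of_bool (a = c) + of_bool (a = d) + of_bool (a = e) + of_bool (b = c) +
    of_bool (b = d) + of_bool (b = e) + of_bool (c = d) + of_bool (c = e) + of_bool (d = e) +
    (E_bit \<eta> \<alpha> s a + E_bit \<eta> \<alpha> s b + E_bit \<eta> \<alpha> s c + E_bit \<eta> \<alpha> s d + E_bit \<eta> \<alpha> s e) +
    (quad (\<alpha> + \<eta> * a) b c d e + quad (\<alpha> + \<eta> * b) a c d e + quad (\<alpha> + \<eta> * c) a b d e +
     quad (\<alpha> + \<eta> * d) a b c e + quad (\<alpha> + \<eta> * e) a b c d))"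

lemma pm_exclusive: "x \<noteq> y \<Longrightarrow> x \<noteq> - y \<Longrightarrow> pm v x = 0 \<or> pm v y = 0"
  unfolding pm_def by auto

lemma pm_le_2: "pm v x \<le> 2"
  unfolding pm_def by simp

lemma pm_le_1: "x \<noteq> 0 \<Longrightarrow> pm v x \<le> 1"
  unfolding pm_def by auto

lemma pm_minus: "pm v (- x) = pm v x"
  unfolding pm_def by simp

text \<open>The sums and differences of the values of two splittings are twice differences of
  entries. So for distinct entries the values differ even up to sign, and at most one
  \<open>pm\<close> term is nonzero.\<close>

lemma quad_1111: "distinct [a, b, c, d] \<Longrightarrow> quad v a b c d \<le> 2"
proof -
  assume d: "distinct [a, b, c, d]"
  let ?x = "a + b - c - d" and ?y = "a + c - b - d" and ?z = "a + d - b - c"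
  have "?x - ?y = 2 * (b - c)" "?x - ?z = 2 * (b - d)" "?y - ?z = 2 * (c - d)"
    "?x - - ?y = 2 * (a - d)" "?x - - ?z = 2 * (a - c)" "?y - - ?z = 2 * (a - b)" by simp_all
  then have "?x \<noteq> ?y" "?x \<noteq> ?z" "?y \<noteq> ?z" "?x \<noteq> - ?y" "?x \<noteq> - ?z" "?y \<noteq> - ?z"
    using d by (metis right_minus_eq mult_eq_0_iff zero_neq_numeral distinct_length_2_or_more)+
  then have "pm v ?x = 0 \<or> pm v ?y = 0" "pm v ?x = 0 \<or> pm v ?z = 0" "pm v ?y = 0 \<or> pm v ?z = 0"
    by (metis pm_exclusive)+
  then show ?thesis using pm_le_2[of v ?x] pm_le_2[of v ?y] pm_le_2[of v ?z] unfolding quad_def by auto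
qed

text \<open>The two splittings that separate the equal entries have opposite values, c - d and d -
  c.\<close>

lemma quad_211_eq: "quad v a a c d = pm v (2 * a - c - d) + 2 * pm v (c - d)"
proof -
  have "a + a - c - d = 2 * a - c - d" "a + c - a - d = c - d" "a + d - a - c = - (c - d)" by simp_all
  then show ?thesis unfolding quad_def by (simp only: pm_minus)
qed

lemma quad_commute: "quad v a b c d = quad v b a c d" "quad v a b c d = quad v a c b d" "quad v a b c d = quad v a b d c"
proof -
  have "b + c - a - d = - (a + d - b - c)" "b + d - a - c = - (a + c - b - d)"
    "a + b - d - c = a + b - c - d" "a + d - c - b = a + d - b - c" "a + c - d - b = a + c - b - d" "b + a - c - d = a + b - c - d" by simp_all
  then show "quad v a b c d = quad v b a c d" "quad v a b c d = quad v a c b d" "quad v a b c d = quad v a b d c"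
    unfolding quad_def by (simp_all only: pm_minus)
qed

lemma quad_211_exclusive:
  assumes "distinct [a, c, d]"
  shows "pm v (2 * a - c - d) = 0 \<or> pm v (c - d) = 0"
proof (rule pm_exclusive)
  show "2 * a - c - d \<noteq> c - d" "2 * a - c - d \<noteq> - (c - d)" using assms by (auto simp: algebra_simps)
qed

lemma quad_211:
  assumes "distinct [a, c, d]"
  shows "quad v a a c d \<le> 2"
  using quad_211_exclusive[OF assms, of v] pm_le_2[of v "2 * a - c - d"] pm_le_1[of "c - d" v] assms
  unfolding quad_211_eq by auto

lemma quad_22: "quad v a a c c = pm v (2 * (a - c)) + 4 * of_bool (v = 0)"
proof -
  have "2 * a - c - c = 2 * (a - c)" by simp
  then show ?thesis unfolding quad_211_eq by (simp add: pm_def)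
qed

lemma quad_22_le: "a \<noteq> c \<Longrightarrow> quad v a a c c \<le> 4"
  unfolding quad_22 pm_def by auto

lemma quad_31: "quad v a a a d = 3 * pm v (a - d)"
proof -
  have "2 * a - a - d = a - d" by simp
  then show ?thesis unfolding quad_211_eq by simp
qed

lemma quad_4: "quad v a a a a = 6 * of_bool (v = 0)"
  unfolding quad_31 pm_def by simp

lemma E_bit_le: "E_bit \<eta> \<alpha> s a \<le> 1"
  unfolding E_bit_def by simp

lemma E_bit_exclusive: "\<eta> \<noteq> 0 \<Longrightarrow> a \<noteq> b \<Longrightarrow> E_bit \<eta> \<alpha> s a = 0 \<or> E_bit \<eta> \<alpha> s b = 0"
  unfolding E_bit_def by (auto simp: algebra_simps)

text \<open>No T, at most five E and at most two R for each c: at most 15.\<close>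

lemma node_count_11111:
  assumes "\<eta> \<noteq> 0" "distinct [a, b, c, d, e]"
  shows "node_count \<eta> \<alpha> a b c d e < 18"
proof -
  have "quad (\<alpha> + \<eta> * a) b c d e \<le> 2" "quad (\<alpha> + \<eta> * b) a c d e \<le> 2" "quad (\<alpha> + \<eta> * c) a b d e \<le> 2"
    "quad (\<alpha> + \<eta> * d) a b c e \<le> 2" "quad (\<alpha> + \<eta> * e) a b c d \<le> 2"
    using assms by (auto intro!: quad_1111)
  moreover have "E_bit \<eta> \<alpha> s a \<le> 1" for s a by (rule E_bit_le)
  note this[of "a + b + c + d + e" a] this[of "a + b + c + d + e" b] this[of "a + b + c + d + e" c]
    this[of "a + b + c + d + e" d] this[of "a + b + c + d + e" e]
  ultimately show ?thesis using assms unfolding node_count_def Let_def by simp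
qed

text \<open>One T, at most five E and at most two R for each c: at most 16.\<close>

lemma node_count_2111:
  assumes "\<eta> \<noteq> 0" "distinct [a, c, d, e]"
  shows "node_count \<eta> \<alpha> a a c d e < 18"
proof -
  have "quad v a c d e \<le> 2" "quad v a a d e \<le> 2" "quad v a a c e \<le> 2" "quad v a a c d \<le> 2" for v
    using assms by (auto intro!: quad_1111 quad_211)
  note this(1)[of "\<alpha> + \<eta> * a"] this(2)[of "\<alpha> + \<eta> * c"] this(3)[of "\<alpha> + \<eta> * d"] this(4)[of "\<alpha> + \<eta> * e"]
  moreover note E_bit_le[of \<eta> \<alpha> "a + a + c + d + e"]
  note this[of a] this[of c] this[of d] this[of e]
  ultimately show ?thesis using assms unfolding node_count_def Let_def by simp
qed

text \<open>Two T, at most two E because the E conditions for different coefficients exclude each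
  other, and at most 4 * 2 + 4 = 12 R: at most 16.\<close>

lemma node_count_221:
  assumes "\<eta> \<noteq> 0" "distinct [a, c, e]"
  shows "node_count \<eta> \<alpha> a a c c e < 18"
proof -
  let ?s = "a + a + c + c + e"
  have "quad v a c c e \<le> 2" for v
  proof -
    have "quad v a c c e = quad v c c a e" using quad_commute by metis
    then show ?thesis using quad_211[of c a e v] assms by auto
  qed
  then have "quad (\<alpha> + \<eta> * a) a c c e \<le> 2" .
  moreover have "quad (\<alpha> + \<eta> * c) a a c e \<le> 2" "quad (\<alpha> + \<eta> * e) a a c c \<le> 4"
    using assms by (auto intro!: quad_211 quad_22_le)
  moreover have "E_bit \<eta> \<alpha> ?s a = 0 \<or> E_bit \<eta> \<alpha> ?s c = 0" "E_bit \<eta> \<alpha> ?s a = 0 \<or> E_bit \<eta> \<alpha> ?s e = 0"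
    "E_bit \<eta> \<alpha> ?s e = 0 \<or> E_bit \<eta> \<alpha> ?s c = 0"
    by (rule E_bit_exclusive; use assms in auto)+
  with E_bit_le[of \<eta> \<alpha> ?s a] E_bit_le[of \<eta> \<alpha> ?s c] E_bit_le[of \<eta> \<alpha> ?s e]
  have "E_bit \<eta> \<alpha> ?s a + E_bit \<eta> \<alpha> ?s a + E_bit \<eta> \<alpha> ?s c + E_bit \<eta> \<alpha> ?s c + E_bit \<eta> \<alpha> ?s e \<le> 2" by linarith
  moreover have "node_count \<eta> \<alpha> a a c c e = 2 +
      (E_bit \<eta> \<alpha> ?s a + E_bit \<eta> \<alpha> ?s a + E_bit \<eta> \<alpha> ?s c + E_bit \<eta> \<alpha> ?s c + E_bit \<eta> \<alpha> ?s e) +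
      (2 * quad (\<alpha> + \<eta> * a) a c c e + 2 * quad (\<alpha> + \<eta> * c) a a c e + quad (\<alpha> + \<eta> * e) a a c c)"
    using assms unfolding node_count_def Let_def by simp
  ultimately show ?thesis by linarith
qed

text \<open>Ten T are counted, and the E and R terms contribute multiples of 5 and 30, so the count
  is a multiple of five.\<close>

lemma node_count_5: "node_count \<eta> \<alpha> a a a a a \<noteq> 18"
  unfolding node_count_def Let_def quad_4 E_bit_def by (auto simp: of_bool_def)

lemma node_count_41_eq:
  assumes "a \<noteq> e"
  shows "node_count \<eta> \<alpha> a a a a e = 6 + 4 * E_bit \<eta> \<alpha> (4 * a + e) a + E_bit \<eta> \<alpha> (4 * a + e) e
    + 12 * pm (\<alpha> + \<eta> * a) (a - e) + 6 * of_bool (\<alpha> + \<eta> * e = 0)"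
proof -
  have "a + a + a + a + e = 4 * a + e" by simp
  then show ?thesis using assms unfolding node_count_def Let_def quad_31 quad_4 by (simp only:) (simp add: pm_def)
qed

text \<open>Without the \<open>pm\<close> term the count is at most 6 + 4 + 1 + 6 = 17.\<close>

lemma node_count_41:
  assumes "a \<noteq> e" "node_count \<eta> \<alpha> a a a a e = 18"
  shows "\<alpha> + \<eta> * a = a - e \<or> \<alpha> + \<eta> * a = e - a"
proof (rule ccontr)
  assume "\<not> ?thesis"
  then have "pm (\<alpha> + \<eta> * a) (a - e) = 0" by (simp add: pm_def)
  moreover have "(of_bool (\<alpha> + \<eta> * e = 0) :: nat) \<le> 1" by simp
  ultimately show False using assms(2) E_bit_le[of \<eta> \<alpha> "4 * a + e" a] E_bit_le[of \<eta> \<alpha> "4 * a + e" e]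
    unfolding node_count_41_eq[OF assms(1)] by linarith
qed

lemma node_count_32_eq:
  assumes "a \<noteq> d"
  shows "node_count \<eta> \<alpha> a a a d d = 4 + 3 * E_bit \<eta> \<alpha> (3 * a + 2 * d) a + 2 * E_bit \<eta> \<alpha> (3 * a + 2 * d) d
    + 3 * (pm (\<alpha> + \<eta> * a) (2 * (a - d)) + 4 * of_bool (\<alpha> + \<eta> * a = 0)) + 6 * pm (\<alpha> + \<eta> * d) (a - d)"
proof -
  have "a + a + a + d + d = 3 * a + 2 * d" by simp
  then show ?thesis using assms unfolding node_count_def Let_def quad_31 quad_22 by (simp only:) simp
qed

text \<open>If \<alpha> + \<eta> a is nonzero, the count is at most 4 + 3 + 3 + 6 = 16.\<close>

lemma node_count_32:
  assumes "\<eta> \<noteq> 0" "a \<noteq> d" "node_count \<eta> \<alpha> a a a d d = 18"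
  shows "\<alpha> + \<eta> * a = 0"
proof (rule ccontr)
  assume "\<alpha> + \<eta> * a \<noteq> 0"
  moreover have "pm (\<alpha> + \<eta> * a) (2 * (a - d)) \<le> 1" "pm (\<alpha> + \<eta> * d) (a - d) \<le> 1"
    using assms(2) by (intro pm_le_1; simp)+
  moreover have "E_bit \<eta> \<alpha> (3 * a + 2 * d) a = 0 \<or> E_bit \<eta> \<alpha> (3 * a + 2 * d) d = 0"
    using assms by (intro E_bit_exclusive)
  ultimately show False using assms(3) E_bit_le[of \<eta> \<alpha> "3 * a + 2 * d" a] E_bit_le[of \<eta> \<alpha> "3 * a + 2 * d" d]
    unfolding node_count_32_eq[OF assms(2)] by auto
qed

lemma node_count_311_eq:
  assumes "distinct [a, y, z]"
  shows "node_count \<eta> \<alpha> a a a y z = 3 + 3 * E_bit \<eta> \<alpha> (3 * a + y + z) a + E_bit \<eta> \<alpha> (3 * a + y + z) y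
    + E_bit \<eta> \<alpha> (3 * a + y + z) z + 3 * quad (\<alpha> + \<eta> * a) a a y z + 3 * pm (\<alpha> + \<eta> * y) (a - z) + 3 * pm (\<alpha> + \<eta> * z) (a - y)"
proof -
  have "a + a + a + y + z = 3 * a + y + z" by simp
  then show ?thesis using assms unfolding node_count_def Let_def quad_31 by (simp only:) simp
qed

lemma zeta_relations:
  fixes \<eta> \<zeta> :: complex
  assumes \<eta>: "\<eta>\<^sup>2 = -3" and \<zeta>: "\<zeta> = (-1 + \<eta>) / 2"
  shows "\<eta> = 2 * \<zeta> + 1" "\<zeta> * \<zeta> + \<zeta> + 1 = 0" "\<zeta> \<noteq> 0" "\<zeta> \<noteq> - 1"
proof -
  have "2 * \<zeta> = - 1 + \<eta>" unfolding \<zeta> by simp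
  then show z1: "\<eta> = 2 * \<zeta> + 1" by simp
  have "4 * (\<zeta> * \<zeta> + \<zeta> + 1) = 0" using \<eta> unfolding z1 power2_eq_square by algebra
  then show "\<zeta> * \<zeta> + \<zeta> + 1 = 0" by (simp only: mult_eq_0_iff) simp
  then show "\<zeta> \<noteq> 0" "\<zeta> \<noteq> - 1" by auto
qed

text \<open>For this pattern 18 = 3 + 3 + 6 + 3 + 3 is the maximum, so every bound is attained. The
  resulting linear equations determine the coefficients up to scaling, shifting and interchanging y
  and z.\<close>

lemma node_count_311:
  assumes \<eta>: "\<eta>\<^sup>2 = -3" and d: "distinct [a, y, z]" and n: "node_count \<eta> \<alpha> a a a y z = 18"
    and \<zeta>: "\<zeta> = (-1 + \<eta>) / 2"
  shows "\<alpha> + \<eta> * a = - \<zeta> * (y - a) \<and> z - a = - \<zeta>\<^sup>2 * (y - a) \<or>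
    \<alpha> + \<eta> * a = - \<zeta> * (z - a) \<and> y - a = - \<zeta>\<^sup>2 * (z - a)"
proof -
  have e: "\<eta> * \<eta> = -3" using \<eta> by (simp add: power2_eq_square)
  have nz: "\<eta> \<noteq> 0" using \<eta> by auto
  let ?s = "3 * a + y + z"
  have q: "quad (\<alpha> + \<eta> * a) a a y z \<le> 2" "pm (\<alpha> + \<eta> * y) (a - z) \<le> 1" "pm (\<alpha> + \<eta> * z) (a - y) \<le> 1"
    by (rule quad_211 pm_le_1; use d in simp)+
  have "E_bit \<eta> \<alpha> ?s a = 0 \<or> E_bit \<eta> \<alpha> ?s y = 0" "E_bit \<eta> \<alpha> ?s a = 0 \<or> E_bit \<eta> \<alpha> ?s z = 0"
    "E_bit \<eta> \<alpha> ?s y = 0 \<or> E_bit \<eta> \<alpha> ?s z = 0"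
    by (rule E_bit_exclusive; use d nz in simp)+
  with q n E_bit_le[of \<eta> \<alpha> ?s a] E_bit_le[of \<eta> \<alpha> ?s y] E_bit_le[of \<eta> \<alpha> ?s z]
  have one: "E_bit \<eta> \<alpha> ?s a = 1" "pm (\<alpha> + \<eta> * y) (a - z) = 1" "pm (\<alpha> + \<eta> * z) (a - y) = 1"
    and two: "quad (\<alpha> + \<eta> * a) a a y z = 2"
    unfolding node_count_311_eq[OF d] by linarith+
  \<comment> \<open>These are the coefficients after subtracting the multiple of the equation of L
    that makes the repeated coefficient zero.\<close>
  define A Y Z where "A = \<alpha> + \<eta> * a" and "Y = y - a" and "Z = z - a"
  have YZ: "Y \<noteq> 0" "Z \<noteq> 0" using d by (auto simp: Y_def Z_def)
  have 1: "3 * A + \<eta> * (Y + Z) = 0"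
    using one(1) unfolding E_bit_def A_def Y_def Z_def by (simp add: algebra_simps of_bool_def split: if_splits)
  have 2: "A + \<eta> * Y = Z \<or> A + \<eta> * Y = - Z"
    using one(2) unfolding pm_def A_def Y_def Z_def by (auto simp: algebra_simps of_bool_def split: if_splits)
  \<comment> \<open>The value 2 of \<open>quad\<close> could also come from a double match of 2 a -
    y - z. That would mean A = 0 and Y = -Z, and then \<open>2\<close> would give \<eta> = 1 or
    \<eta> = -1.\<close>
  have 3: "A = Y - Z \<or> A = Z - Y"
  proof (rule ccontr)
    assume "\<not> ?thesis"
    then have "pm (\<alpha> + \<eta> * a) (y - z) = 0" by (auto simp: pm_def A_def Y_def Z_def)
    then have "pm (\<alpha> + \<eta> * a) (2 * a - y - z) = 2" using two by (simp add: quad_211_eq)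
    then have "\<alpha> + \<eta> * a = 2 * a - y - z" "\<alpha> + \<eta> * a = - (2 * a - y - z)"
      by (auto simp: pm_def of_bool_def split: if_splits)
    then have "A = 0" "Y + Z = 0" unfolding A_def Y_def Z_def by algebra+
    then have "(\<eta> - 1) * Z = 0 \<or> (\<eta> + 1) * Z = 0" using 2 by algebra
    then show False using YZ \<eta> by (auto simp: add_eq_0_iff2)
  qed
  note z = zeta_relations(1,2)[OF \<eta> \<zeta>]
  \<comment> \<open>The alternative A = Z - Y is this case with Y and Z interchanged, so one sign
    suffices.\<close>
  have "A = - \<zeta> * Y \<and> Z = - (\<zeta> * \<zeta>) * Y" if "A = Y - Z" "3 * A + \<eta> * (Y + Z) = 0" for Y Z
  proof -
    have "3 * (Z + \<zeta> * \<zeta> * Y) = 0" using that z by algebra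
    then have "Z + \<zeta> * \<zeta> * Y = 0" by (simp only: mult_eq_0_iff) simp
    then have Z: "Z = - (\<zeta> * \<zeta>) * Y" by (simp add: eq_neg_iff_add_eq_0)
    moreover have "A = - \<zeta> * Y" using that(1) Z z(2) by algebra
    ultimately show ?thesis by blast
  qed
  from this[of Y Z] this[of Z Y] 1 3 show ?thesis
    unfolding A_def[symmetric] Y_def[symmetric] Z_def[symmetric] power2_eq_square by (auto simp: add.commute)
qed

section \<open>Incidence of the nodes with a kernel\<close>

lemma functional_enum:
  assumes "enum5 i j k l m"
  shows "functional \<alpha> h x = \<alpha> * x$0 + h i * x$i + h j * x$j + h k * x$k + h l * x$l + h m * x$m"
  using assms unfolding enum5_def functional_def by (simp add: add.assoc)

lemma card_filter: "finite S \<Longrightarrow> card {x \<in> S. P x} = (\<Sum>x\<in>S. of_bool (P x))"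
  by (simp add: Collect_conj_eq)

lemma pairs_insert:
  assumes "finite I" "i \<notin> I"
  shows "pairs (insert i I) = pairs I \<union> (\<lambda>j. {i, j}) ` I"
proof -
  have "{J. J \<subseteq> I \<and> card J = Suc 0} = (\<lambda>j. {j}) ` I" by (auto simp: card_Suc_eq)
  then have "insert i ` {J. J \<subseteq> I \<and> card J = Suc 0} = (\<lambda>j. {i, j}) ` I" by (simp add: image_image)
  then show ?thesis
    using subsets_card_Suc_insert[OF assms, of "Suc 0"] by (simp add: pairs_def numeral_2_eq_2)
qed

lemma sum_pairs_insert:
  assumes "finite I" "i \<notin> I"
  shows "(\<Sum>A\<in>pairs (insert i I). f A) = (\<Sum>j\<in>I. f {i, j}) + (\<Sum>A\<in>pairs I. f A)"
proof -
  have "inj_on (\<lambda>j. {i, j}) I" by (auto simp: inj_on_def doubleton_eq_iff)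
  moreover have "pairs I \<inter> (\<lambda>j. {i, j}) ` I = {}" using assms(2) by (auto simp: pairs_def)
  ultimately show ?thesis
    using assms by (simp add: pairs_insert sum.union_disjoint finite_pairs sum.reindex o_def add.commute)
qed

lemma pairs_empty: "pairs {} = {}"
  by (auto simp: pairs_iff)

lemma functional_axis: "p \<in> {1..5} \<Longrightarrow> functional \<alpha> h (axis p 1) = h p"
  unfolding functional_def by (auto simp: axis_def index_set sum.delta' if_distrib cong: if_cong)

lemma T_vec_in_kernel:
  assumes "\<eta>\<^sup>2 = -3" "p \<noteq> q" "p \<in> {1..5}" "q \<in> {1..5}"
  shows "T_vec {p, q} \<in> L_kernel \<eta> \<alpha> h \<longleftrightarrow> h p = h q"
proof -
  have "{p, q} \<in> pairs {1..5}" unfolding pairs_iff using assms by blast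
  then have "T_vec {p, q} \<in> node_vecs \<eta>" by (auto simp: node_vecs_def)
  then have "T_vec {p, q} \<in> L_space \<eta>"
    using node_vecs_node[OF assms(1)] by (auto simp: node_at_def singular_at_def)
  moreover have "functional \<alpha> h (T_vec {p, q}) = h p - h q \<or> functional \<alpha> h (T_vec {p, q}) = h q - h p"
    using T_vec_cases[of p q] assms(3,4) by (auto simp: functional_linear functional_axis)
  ultimately show ?thesis by (auto simp: L_kernel_def)
qed

lemma E_vec_in_kernel:
  assumes e: "enum5 i j k l m" and \<eta>: "\<eta>\<^sup>2 = -3"
  shows "E_vec \<eta> m \<in> L_kernel \<eta> \<alpha> h \<longleftrightarrow> 3 * \<alpha> + \<eta> * (h i + h j + h k + h l + h m - 2 * h m) = 0"
proof -
  have "E_vec \<eta> m \<in> node_vecs \<eta>" using enum5_members[OF e] by (auto simp: node_vecs_def)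
  then have "E_vec \<eta> m \<in> L_space \<eta>"
    using node_vecs_node[OF \<eta>] by (auto simp: node_at_def singular_at_def)
  moreover have "3 * functional \<alpha> h (E_vec \<eta> m) = 3 * \<alpha> + \<eta> * (h i + h j + h k + h l + h m - 2 * h m)"
    by (simp add: functional_enum[OF e] E_vec_enum[OF e] algebra_simps)
  ultimately show ?thesis by (auto simp: L_kernel_def)
qed

lemma R_vec_in_kernel:
  assumes e: "enum5 i j k l m" and \<eta>: "\<eta>\<^sup>2 = -3"
  shows "R_vec \<eta> m {i, j} \<in> L_kernel \<eta> \<alpha> h \<longleftrightarrow> \<alpha> + \<eta> * h m = h i + h j - h k - h l"
proof -
  have "R_vec \<eta> m {i, j} \<in> node_vecs \<eta>" using enum5_members[OF e] by (force simp: node_vecs_def)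
  then have "R_vec \<eta> m {i, j} \<in> L_space \<eta>"
    using node_vecs_node[OF \<eta>] by (auto simp: node_at_def singular_at_def)
  moreover have "functional \<alpha> h (R_vec \<eta> m {i, j}) = (\<alpha> + \<eta> * h m) - (h i + h j - h k - h l)"
    by (simp add: functional_enum[OF e] R_vec_enum[OF e] algebra_simps)
  ultimately show ?thesis by (auto simp: L_kernel_def)
qed

text \<open>The six pairs in a set of four indices form three complementary couples. The two
  conditions of a couple differ only by a sign, and each couple is one \<open>pm\<close>
  term.\<close>

lemma R_count_quad:
  assumes e: "enum5 i j k l m" and \<eta>: "\<eta>\<^sup>2 = -3"
  shows "card {A \<in> pairs ({1..5} - {m}). R_vec \<eta> m A \<in> L_kernel \<eta> \<alpha> h} = quad (\<alpha> + \<eta> * h m) (h i) (h j) (h k) (h l)"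
proof -
  have d: "distinct [i, j, k, l, m]" and I: "{1..5} - {m} = {i, j, k, l}" using e unfolding enum5_def by auto
  have e': "enum5 i k j l m" "enum5 i l j k m" "enum5 j k i l m" "enum5 j l i k m" "enum5 k l i j m"
    using e unfolding enum5_def by auto
  show ?thesis
    unfolding I card_filter[OF finite_pairs[OF finite]]
    using d by (simp add: sum_pairs_insert pairs_empty R_vec_in_kernel[OF _ \<eta>, OF e] R_vec_in_kernel[OF _ \<eta>, OF e'(1)]
      R_vec_in_kernel[OF _ \<eta>, OF e'(2)] R_vec_in_kernel[OF _ \<eta>, OF e'(3)] R_vec_in_kernel[OF _ \<eta>, OF e'(4)]
      R_vec_in_kernel[OF _ \<eta>, OF e'(5)] quad_def pm_def algebra_simps del: sum_of_bool_eq)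
qed

lemma card_nodes_L_kernel:
  assumes e: "enum5 i j k l m" and \<eta>: "\<eta>\<^sup>2 = -3"
  shows "card {P \<in> nodes (L_space \<eta>) X_form. P \<subseteq> L_kernel \<eta> \<alpha> h} =
    node_count \<eta> \<alpha> (h i) (h j) (h k) (h l) (h m)"
proof -
  have d: "distinct [i, j, k, l, m]" and I: "{1..5} = {i, j, k, l, m}" using e unfolding enum5_def by auto
  have e': "enum5 j k l m i" "enum5 i k l m j" "enum5 i j l m k" "enum5 i j k m l"
    using e unfolding enum5_def by auto
  have T: "card {C \<in> pairs {1..5}. T_vec C \<in> L_kernel \<eta> \<alpha> h} =
    of_bool (h i = h j) + of_bool (h i = h k) + of_bool (h i = h l) + of_bool (h i = h m) + of_bool (h j = h k) +
    of_bool (h j = h l) + of_bool (h j = h m) + of_bool (h k = h l) + of_bool (h k = h m) + of_bool (h l = h m)"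
    unfolding card_filter[OF finite_pairs[OF finite]] using d T_vec_in_kernel[OF \<eta>, of _ _ \<alpha> h]
    by (simp add: I sum_pairs_insert pairs_empty del: sum_of_bool_eq)
  let ?s = "h i + h j + h k + h l + h m"
  have E: "card {c \<in> {1..5}. E_vec \<eta> c \<in> L_kernel \<eta> \<alpha> h} =
    E_bit \<eta> \<alpha> ?s (h i) + E_bit \<eta> \<alpha> ?s (h j) + E_bit \<eta> \<alpha> ?s (h k) + E_bit \<eta> \<alpha> ?s (h l) + E_bit \<eta> \<alpha> ?s (h m)"
    unfolding card_filter[OF finite] using d
    by (simp add: I E_bit_def E_vec_in_kernel[OF e \<eta>] E_vec_in_kernel[OF e'(1) \<eta>] E_vec_in_kernel[OF e'(2) \<eta>]
      E_vec_in_kernel[OF e'(3) \<eta>] E_vec_in_kernel[OF e'(4) \<eta>] ac_simps del: sum_of_bool_eq)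
  have R: "(\<Sum>c\<in>{1..5}. card {A \<in> pairs ({1..5} - {c}). R_vec \<eta> c A \<in> L_kernel \<eta> \<alpha> h}) =
    quad (\<alpha> + \<eta> * h i) (h j) (h k) (h l) (h m) + quad (\<alpha> + \<eta> * h j) (h i) (h k) (h l) (h m) +
    quad (\<alpha> + \<eta> * h k) (h i) (h j) (h l) (h m) + quad (\<alpha> + \<eta> * h l) (h i) (h j) (h k) (h m) +
    quad (\<alpha> + \<eta> * h m) (h i) (h j) (h k) (h l)"
    unfolding R_count_quad[OF e \<eta>, symmetric] R_count_quad[OF e'(1) \<eta>, symmetric] R_count_quad[OF e'(2) \<eta>, symmetric]
      R_count_quad[OF e'(3) \<eta>, symmetric] R_count_quad[OF e'(4) \<eta>, symmetric]
    using d by (simp only: I sum.insert) (simp add: add.assoc)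
  show ?thesis
    unfolding card_nodes_subspace[OF \<eta> L_kernel_subspace] T E R node_count_def Let_def by simp
qed

section \<open>Steiner hyperplanes\<close>

lemma functional_axis_0: "functional \<alpha> h (axis 0 1) = \<alpha>"
  unfolding functional_def by (auto simp: axis_def index_set intro!: sum.neutral)

lemma L_space_functional: "L_space \<eta> = {x. functional (- \<eta>) (\<lambda>_. 1) x = 0}"
  unfolding L_space_def functional_def by (auto simp: algebra_simps)

text \<open>Subtracting t times u_1 + ... + u_5 - \<eta> a does not change a functional on L; after
  this shift the two functionals differ by the factor \<open>c\<close>.\<close>

lemma L_kernel_eqI:
  assumes "enum5 i j k l m" "c \<noteq> 0" "\<alpha> + \<eta> * t = c * \<alpha>'"
    "h i - t = c * h' i" "h j - t = c * h' j" "h k - t = c * h' k" "h l - t = c * h' l" "h m - t = c * h' m"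
  shows "L_kernel \<eta> \<alpha> h = L_kernel \<eta> \<alpha>' h'"
proof -
  have "functional \<alpha> h x = c * functional \<alpha>' h' x" if "x \<in> L_space \<eta>" for x
  proof -
    have s: "x$i + x$j + x$k + x$l + x$m = \<eta> * x$0" using that by (simp add: L_space_enum[OF assms(1)])
    show ?thesis unfolding functional_enum[OF assms(1)] using assms(3-) s by algebra
  qed
  then show ?thesis using \<open>c \<noteq> 0\<close> unfolding L_kernel_def by auto
qed

lemma pm_self: "x \<noteq> 0 \<Longrightarrow> pm x x = 1"
  unfolding pm_def by simp

lemma sum_coord: "i \<in> {1..5} \<Longrightarrow> (\<Sum>n\<in>{1..5}. of_bool (n = i) * (x :: complex ^ 6) $ n) = x $ i"
  by (simp add: of_bool_def if_distrib[of "\<lambda>c. c * _"] sum.delta' cong: if_cong)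

lemma sum_coord2:
  assumes "p \<in> {1..5}" "q \<in> {1..5}"
  shows "(\<Sum>n\<in>{1..5}. (a * of_bool (n = p) + b * of_bool (n = q)) * (x :: complex ^ 6) $ n) = a * x $ p + b * x $ q"
  using assms
  by (simp add: distrib_right sum.distrib mult.assoc sum_distrib_left[symmetric] sum_coord del: sum_of_bool_mult_eq)

section \<open>The families F, G, K and S as kernels\<close>

lemma F_hyp_L_kernel: "i \<in> {1..5} \<Longrightarrow> F_hyp \<eta> i = L_kernel \<eta> 1 (\<lambda>n. of_bool (n = i))"
  unfolding F_hyp_def L_kernel_def functional_def by (simp add: sum_coord del: sum_of_bool_mult_eq)

lemma G_hyp_L_kernel: "i \<in> {1..5} \<Longrightarrow> G_hyp \<eta> i = L_kernel \<eta> 1 (\<lambda>n. - of_bool (n = i))"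
  unfolding G_hyp_def L_kernel_def functional_def
  by (simp add: sum_coord sum_negf del: sum_of_bool_mult_eq)

lemma K_hyp_L_kernel:
  "p \<in> {1..5} \<Longrightarrow> q \<in> {1..5} \<Longrightarrow> K_hyp \<eta> p q = L_kernel \<eta> 0 (\<lambda>n. of_bool (n = p) + of_bool (n = q))"
  unfolding K_hyp_def L_kernel_def functional_def
  by (simp add: sum_coord distrib_right sum.distrib del: sum_of_bool_mult_eq)

lemma S_hyp_L_kernel:
  "p \<in> {1..5} \<Longrightarrow> q \<in> {1..5} \<Longrightarrow>
    S_hyp \<eta> \<zeta> p q = L_kernel \<eta> 1 (\<lambda>n. - \<zeta>\<^sup>2 * of_bool (n = p) + \<zeta> * of_bool (n = q))"
  unfolding S_hyp_def L_kernel_def functional_def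
  by (simp only: sum_coord2) (simp add: algebra_simps)

text \<open>For a kernel these are the indices whose coefficient occurs only once. Stated through
  nodes, the set depends on H alone. It has one element for F and G, none for K and two for
  S.\<close>

definition lone :: "(complex ^ 6) set \<Rightarrow> 6 set" where
  "lone H = {r \<in> {1..5}. \<forall>s\<in>{1..5}. s \<noteq> r \<longrightarrow> T_vec {r, s} \<notin> H}"

context
  fixes \<eta> \<zeta> :: complex
  assumes \<eta>: "\<eta>\<^sup>2 = -3" and \<zeta>: "\<zeta> = (-1 + \<eta>) / 2"
begin

lemmas zeta = zeta_relations[OF \<eta> \<zeta>]

lemma zeta_sq: "\<zeta>\<^sup>2 = - \<zeta> - 1"
  using zeta(2) by (simp add: power2_eq_square eq_neg_iff_add_eq_0 algebra_simps)

text \<open>The point is that a kernel with count 18 is a proper subspace of L. Otherwise it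
  contains every T, so all coefficients agree and \<open>node_count_5\<close> applies.\<close>

lemma steiner_L_kernel_iff:
  assumes e: "enum5 i j k l m"
  shows "L_kernel \<eta> \<alpha> h \<in> steiner_hyperplanes_X \<eta> \<longleftrightarrow> node_count \<eta> \<alpha> (h i) (h j) (h k) (h l) (h m) = 18"
proof -
  have "hyperplane_of (L_space \<eta>) (L_kernel \<eta> \<alpha> h)" if c: "node_count \<eta> \<alpha> (h i) (h j) (h k) (h l) (h m) = 18"
  proof (rule ccontr)
    assume "\<not> ?thesis"
    then have L: "L_space \<eta> \<subseteq> L_kernel \<eta> \<alpha> h" using hyperplane_L_kernel by blast
    have "h p = h q" if "p \<noteq> q" "p \<in> {1..5}" "q \<in> {1..5}" for p q
    proof -
      have "{p, q} \<in> pairs {1..5}" unfolding pairs_iff using that by blast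
      then have "T_vec {p, q} \<in> L_space \<eta>"
        using node_vecs_node[OF \<eta>, of "T_vec {p, q}"] by (auto simp: node_vecs_def node_at_def singular_at_def)
      then show ?thesis using L T_vec_in_kernel[OF \<eta> that] by blast
    qed
    then have "h j = h i" "h k = h i" "h l = h i" "h m = h i" using e unfolding enum5_def by auto
    then show False using c node_count_5 by simp
  qed
  then show ?thesis
    unfolding steiner_hyperplanes_X_def steiner_hyperplane_def
    using card_nodes_L_kernel[OF e \<eta>, of \<alpha> h] by (simp, blast)
qed

text \<open>The eighteen nodes are six T and twelve R; no E lies on F because \<eta> is neither 3
  nor -3. The count for G is the same.\<close>

lemma F_steiner: "i \<in> {1..5} \<Longrightarrow> F_hyp \<eta> i \<in> steiner_hyperplanes_X \<eta>"
proof -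
  assume i: "i \<in> {1..5}"
  then obtain j k l m where e: "enum5 j k l m i" using enum5_extend1 by blast
  then have "j \<noteq> i" "k \<noteq> i" "l \<noteq> i" "m \<noteq> i" unfolding enum5_def by auto
  then show ?thesis
    unfolding F_hyp_L_kernel[OF i] steiner_L_kernel_iff[OF e]
    using eta_distinct[OF \<eta>] eta_nonzero[OF \<eta>]
    by (simp add: node_count_41_eq E_bit_def pm_def add_eq_0_iff)
qed

lemma G_steiner: "i \<in> {1..5} \<Longrightarrow> G_hyp \<eta> i \<in> steiner_hyperplanes_X \<eta>"
proof -
  assume i: "i \<in> {1..5}"
  then obtain j k l m where e: "enum5 j k l m i" using enum5_extend1 by blast
  then have "j \<noteq> i" "k \<noteq> i" "l \<noteq> i" "m \<noteq> i" unfolding enum5_def by auto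
  then show ?thesis
    unfolding G_hyp_L_kernel[OF i] steiner_L_kernel_iff[OF e]
    using eta_distinct[OF \<eta>] eta_nonzero[OF \<eta>]
    by (simp add: node_count_41_eq E_bit_def pm_def add_eq_0_iff)
qed

text \<open>The eighteen nodes are four T, the two nodes E_p and E_q, and twelve R.\<close>

lemma K_steiner:
  assumes "p \<noteq> q" "p \<in> {1..5}" "q \<in> {1..5}"
  shows "K_hyp \<eta> p q \<in> steiner_hyperplanes_X \<eta>"
proof -
  obtain k l m where e': "enum5 p q k l m" using enum5_extend2[OF assms] by blast
  then have e: "enum5 k l m p q" and "k \<noteq> p" "l \<noteq> p" "m \<noteq> p" "k \<noteq> q" "l \<noteq> q" "m \<noteq> q" "q \<noteq> p" unfolding enum5_def by auto
  then show ?thesis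
    unfolding K_hyp_L_kernel[OF assms(2,3)] steiner_L_kernel_iff[OF e]
    using eta_distinct[OF \<eta>] eta_nonzero[OF \<eta>] assms(1)
    by (simp add: node_count_32_eq E_bit_def pm_def)
qed

text \<open>The eighteen nodes are three T, three E and twelve R, so all bounds for the pattern
  3+1+1 are attained.\<close>

lemma S_steiner:
  assumes "p \<noteq> q" "p \<in> {1..5}" "q \<in> {1..5}"
  shows "S_hyp \<eta> \<zeta> p q \<in> steiner_hyperplanes_X \<eta>"
proof -
  obtain k l m where e': "enum5 p q k l m" using enum5_extend2[OF assms] by blast
  then have e: "enum5 k l m p q" and ne: "k \<noteq> p" "l \<noteq> p" "m \<noteq> p" "k \<noteq> q" "l \<noteq> q" "m \<noteq> q" "q \<noteq> p" unfolding enum5_def by auto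
  have z: "\<eta> = 2 * \<zeta> + 1" "\<zeta> * \<zeta> = - \<zeta> - 1" using zeta by (simp_all add: zeta_sq power2_eq_square[symmetric])
  have d: "distinct [0, 1 + \<zeta>, \<zeta>]" using zeta(3,4) by (auto simp: add_eq_0_iff)
  \<comment> \<open>The coefficients of S are -\<zeta>^2 = 1 + \<zeta> at p, \<zeta> at q and 0 at
    the other three indices; their sum is \<eta>.\<close>
  have "node_count \<eta> 1 0 0 0 (1 + \<zeta>) \<zeta> = 18"
  proof -
    have "E_bit \<eta> 1 (3 * 0 + (1 + \<zeta>) + \<zeta>) 0 = 1"
    proof -
      have "3 * 1 + \<eta> * (3 * 0 + (1 + \<zeta>) + \<zeta> - 2 * 0) = 0" unfolding z(1) using z(2) by algebra
      then show ?thesis by (simp add: E_bit_def)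
    qed
    moreover from this have "E_bit \<eta> 1 (3 * 0 + (1 + \<zeta>) + \<zeta>) (1 + \<zeta>) = 0" "E_bit \<eta> 1 (3 * 0 + (1 + \<zeta>) + \<zeta>) \<zeta> = 0"
      using E_bit_exclusive[OF eta_nonzero[OF \<eta>], of 0 "1 + \<zeta>" 1 "3 * 0 + (1 + \<zeta>) + \<zeta>"]
        E_bit_exclusive[OF eta_nonzero[OF \<eta>], of 0 \<zeta> 1 "3 * 0 + (1 + \<zeta>) + \<zeta>"] d by auto
    moreover have "quad (1 + \<eta> * 0) 0 0 (1 + \<zeta>) \<zeta> = 2"
      unfolding quad_211_eq using eta_distinct[OF \<eta>] quad_211_exclusive[OF d, of 1] by (auto simp: pm_def)
    moreover have "pm (1 + \<eta> * (1 + \<zeta>)) (0 - \<zeta>) = 1"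
    proof -
      have "1 + \<eta> * (1 + \<zeta>) = \<zeta>" unfolding z(1) using z(2) by algebra
      then show ?thesis using zeta(3) by (simp add: pm_def)
    qed
    moreover have "pm (1 + \<eta> * \<zeta>) (0 - (1 + \<zeta>)) = 1"
    proof -
      have "1 + \<eta> * \<zeta> = - (1 + \<zeta>)" unfolding z(1) using z(2) by algebra
      moreover have "- (1 + \<zeta>) \<noteq> 0" using d by (simp only: neg_equal_0_iff_equal) simp
      then have "pm (- (1 + \<zeta>)) (- (1 + \<zeta>)) = 1" by (rule pm_self)
      ultimately show ?thesis by (simp only: diff_0)
    qed
    ultimately show ?thesis unfolding node_count_311_eq[OF d] by simp
  qed
  then show ?thesis
    unfolding S_hyp_L_kernel[OF assms(2,3)] steiner_L_kernel_iff[OF e] using ne by (simp add: zeta_sq add.commute)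
qed

text \<open>Only the patterns 4+1, 3+2 and 3+1+1 admit the count 18. There the repeated coefficient
  serves as the shift \<open>t\<close> in \<open>L_kernel_eqI\<close>, and the value forced on
  \<alpha> + \<eta> t identifies the family.\<close>

lemma steiner_cases:
  assumes H: "H \<in> steiner_hyperplanes_X \<eta>"
  obtains (F) i where "i \<in> {1..5}" "H = F_hyp \<eta> i" | (G) i where "i \<in> {1..5}" "H = G_hyp \<eta> i"
    | (K) p q where "p \<noteq> q" "p \<in> {1..5}" "q \<in> {1..5}" "H = K_hyp \<eta> p q"
    | (S) p q where "p \<noteq> q" "p \<in> {1..5}" "q \<in> {1..5}" "H = S_hyp \<eta> \<zeta> p q"
proof -
  have "hyperplane_of (L_space \<eta>) H" using H by (simp add: steiner_hyperplanes_X_def steiner_hyperplane_def)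
  then obtain \<alpha> h where Hk: "H = L_kernel \<eta> \<alpha> h" using hyperplane_is_L_kernel by blast
  obtain i j k l m where e: "enum5 i j k l m" and p: "pattern5 (h i) (h j) (h k) (h l) (h m)"
    using pattern5_exists[of h] by blast
  have n: "node_count \<eta> \<alpha> (h i) (h j) (h k) (h l) (h m) = 18"
    using H unfolding Hk steiner_L_kernel_iff[OF e] .
  have ne: "i \<noteq> j" "i \<noteq> k" "i \<noteq> l" "i \<noteq> m" "j \<noteq> k" "j \<noteq> l" "j \<noteq> m" "k \<noteq> l" "k \<noteq> m" "l \<noteq> m"
    using e unfolding enum5_def by auto
  have mem: "l \<in> {1..5}" "m \<in> {1..5}" using e unfolding enum5_def by auto
  consider "h i = h j" "h j = h k" "h k = h l" "h l = h m"
    | "h i = h j" "h j = h k" "h k = h l" "h l \<noteq> h m"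
    | "h i = h j" "h j = h k" "h l = h m" "h k \<noteq> h l"
    | "h i = h j" "h j = h k" "distinct [h k, h l, h m]"
    | "h i = h j" "h k = h l" "distinct [h j, h k, h m]"
    | "h i = h j" "distinct [h j, h k, h l, h m]"
    | "distinct [h i, h j, h k, h l, h m]"
    using p unfolding pattern5_def by argo
  then show thesis
  proof cases
    case 1
    then show ?thesis using n node_count_5 by simp
  next
    case 2
    then have "\<alpha> + \<eta> * h l = h l - h m \<or> \<alpha> + \<eta> * h l = h m - h l"
      using n by (intro node_count_41) simp_all
    then show ?thesis
    proof
      assume "\<alpha> + \<eta> * h l = h l - h m"
      then have "H = G_hyp \<eta> m" unfolding Hk G_hyp_L_kernel[OF mem(2)] using 2 ne
        by (intro L_kernel_eqI[OF e, of "h l - h m" _ _ "h l"]) simp_all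
      then show ?thesis using G mem by blast
    next
      assume "\<alpha> + \<eta> * h l = h m - h l"
      then have "H = F_hyp \<eta> m" unfolding Hk F_hyp_L_kernel[OF mem(2)] using 2 ne
        by (intro L_kernel_eqI[OF e, of "h m - h l" _ _ "h l"]) simp_all
      then show ?thesis using F mem by blast
    qed
  next
    case 3
    then have "\<alpha> + \<eta> * h k = 0"
      using n by (intro node_count_32[OF eta_nonzero[OF \<eta>], of _ "h m"]) simp_all
    then have "H = K_hyp \<eta> l m" unfolding Hk K_hyp_L_kernel[OF mem] using 3 ne
      by (intro L_kernel_eqI[OF e, of "h m - h k" _ _ "h k"]) simp_all
    then show ?thesis using K mem ne by blast
  next
    case 4
    then have "\<alpha> + \<eta> * h k = - \<zeta> * (h l - h k) \<and> h m - h k = - \<zeta>\<^sup>2 * (h l - h k) \<or>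
      \<alpha> + \<eta> * h k = - \<zeta> * (h m - h k) \<and> h l - h k = - \<zeta>\<^sup>2 * (h m - h k)"
      using n by (intro node_count_311[OF \<eta> _ _ \<zeta>]) simp_all
    moreover have "H = S_hyp \<eta> \<zeta> p q"
      if e': "enum5 i j k p q" and eqs: "\<alpha> + \<eta> * h k = - \<zeta> * (h p - h k)" "h q - h k = - \<zeta>\<^sup>2 * (h p - h k)"
        and "h p \<noteq> h k" for p q
    proof -
      have ne': "i \<noteq> p" "i \<noteq> q" "j \<noteq> p" "j \<noteq> q" "k \<noteq> p" "k \<noteq> q" "p \<noteq> q" "q \<noteq> p" and pq: "p \<in> {1..5}" "q \<in> {1..5}"
        using e' unfolding enum5_def by auto
      show ?thesis unfolding Hk S_hyp_L_kernel[OF pq]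
      proof (rule L_kernel_eqI[OF e', of "- \<zeta> * (h p - h k)" _ _ "h k"])
        show "- \<zeta> * (h p - h k) \<noteq> 0" using zeta(3) \<open>h p \<noteq> h k\<close> by simp
        \<comment> \<open>The scale is \<alpha> + \<eta> \<open>h k\<close>, since S has coefficient
          1 at a. The identity amounts to -\<zeta> (\<zeta> + 1) = 1.\<close>
        have "h p - h k = - \<zeta> * (h p - h k) * (\<zeta> + 1)" using zeta(2) by algebra
        then show "h p - h k = - \<zeta> * (h p - h k) * (- \<zeta>\<^sup>2 * of_bool (p = p) + \<zeta> * of_bool (p = q))"
          using ne' by (simp add: zeta_sq algebra_simps)
        show "h q - h k = - \<zeta> * (h p - h k) * (- \<zeta>\<^sup>2 * of_bool (q = p) + \<zeta> * of_bool (q = q))"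
          using ne' eqs(2) by (simp add: power2_eq_square)
      qed (use eqs(1) 4(1,2) ne' in simp_all)
    qed
    moreover have "enum5 i j k m l" using e by (rule enum5_swap)
    ultimately have "H = S_hyp \<eta> \<zeta> l m \<or> H = S_hyp \<eta> \<zeta> m l" using e 4(3) by (metis distinct_length_2_or_more)
    then show ?thesis using S mem ne by metis
  next
    case 5
    then show ?thesis using n node_count_221[OF eta_nonzero[OF \<eta>], of "h j" "h k" "h m" \<alpha>] by simp
  next
    case 6
    then show ?thesis using n node_count_2111[OF eta_nonzero[OF \<eta>], of "h j" "h k" "h l" "h m" \<alpha>] by simp
  next
    case 7
    then show ?thesis using n node_count_11111[OF eta_nonzero[OF \<eta>] 7, of \<alpha>] by simp
  qed
qed

section \<open>Telling the hyperplanes apart\<close>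

lemma lone_L_kernel: "lone (L_kernel \<eta> \<alpha> h) = {r \<in> {1..5}. \<forall>s\<in>{1..5}. s \<noteq> r \<longrightarrow> h s \<noteq> h r}"
  unfolding lone_def using T_vec_in_kernel[OF \<eta>, of _ _ \<alpha> h] by fastforce

lemma lone_F:
  assumes i: "i \<in> {1..5}"
  shows "lone (F_hyp \<eta> i) = {i}"
proof -
  obtain j k l m where e: "enum5 j k l m i" using enum5_extend1[OF i] by blast
  then have I: "{1..5} = {j, k, l, m, i}" and d: "distinct [j, k, l, m, i]" by (simp_all only: enum5_def)
  show ?thesis unfolding F_hyp_L_kernel[OF i] lone_L_kernel I using d by auto
qed

lemma lone_G:
  assumes i: "i \<in> {1..5}"
  shows "lone (G_hyp \<eta> i) = {i}"
proof -
  obtain j k l m where e: "enum5 j k l m i" using enum5_extend1[OF i] by blast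
  then have I: "{1..5} = {j, k, l, m, i}" and d: "distinct [j, k, l, m, i]" by (simp_all only: enum5_def)
  show ?thesis unfolding G_hyp_L_kernel[OF i] lone_L_kernel I using d by auto
qed

lemma lone_K:
  assumes pq: "p \<noteq> q" "p \<in> {1..5}" "q \<in> {1..5}"
  shows "lone (K_hyp \<eta> p q) = {}"
proof -
  obtain k l m where e: "enum5 p q k l m" using enum5_extend2[OF pq] by blast
  then have I: "{1..5} = {p, q, k, l, m}" and d: "distinct [p, q, k, l, m]" by (simp_all only: enum5_def)
  show ?thesis unfolding K_hyp_L_kernel[OF pq(2,3)] lone_L_kernel I using d by auto
qed

lemma lone_S:
  assumes pq: "p \<noteq> q" "p \<in> {1..5}" "q \<in> {1..5}"
  shows "lone (S_hyp \<eta> \<zeta> p q) = {p, q}"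
proof -
  obtain k l m where e: "enum5 p q k l m" using enum5_extend2[OF pq] by blast
  then have I: "{1..5} = {p, q, k, l, m}" and d: "distinct [p, q, k, l, m]" by (simp_all only: enum5_def)
  have "1 + \<zeta> \<noteq> 0" using zeta(4) by (simp add: add_eq_0_iff)
  then show ?thesis unfolding S_hyp_L_kernel[OF pq(2,3)] lone_L_kernel I
    using d zeta(3) by (auto simp: zeta_sq add.commute)
qed

lemma F_neq_G:
  assumes i: "i \<in> {1..5}"
  shows "F_hyp \<eta> i \<noteq> G_hyp \<eta> i"
proof -
  obtain j k l m where e: "enum5 j k l m i" using enum5_extend1[OF i] by blast
  then have j: "j \<in> {1..5}" "j \<noteq> i" unfolding enum5_def by auto
  \<comment> \<open>Here a = 1 and u_i = -1, so a + u_i = 0 but a - u_i = 2; the entry u_j = \<eta>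
    + 1 puts the point into L.\<close>
  let ?x = "axis 0 1 - axis i 1 + (\<eta> + 1) *s axis j 1 :: complex ^ 6"
  have "?x \<in> F_hyp \<eta> i" "?x \<notin> G_hyp \<eta> i"
    using i j unfolding F_hyp_L_kernel[OF i] G_hyp_L_kernel[OF i] L_kernel_def L_space_functional
    by (simp_all add: functional_linear functional_axis functional_axis_0)
  then show ?thesis by blast
qed

lemma S_neq_swap:
  assumes pq: "p \<noteq> q" "p \<in> {1..5}" "q \<in> {1..5}"
  shows "S_hyp \<eta> \<zeta> p q \<noteq> S_hyp \<eta> \<zeta> q p"
proof -
  obtain k l m where e: "enum5 p q k l m" using enum5_extend2[OF pq] by blast
  then have k: "k \<in> {1..5}" "k \<noteq> p" "k \<noteq> q" unfolding enum5_def by auto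
  \<comment> \<open>With a = 1, u_p = \<zeta> and u_q = 0, the form of S_pq takes the value 1 -
    \<zeta>^3 = 0 and that of S_qp the value 1 + \<zeta>^2 = -\<zeta>. The entry u_k puts the point
    into L.\<close>
  let ?x = "axis 0 1 + \<zeta> *s axis p 1 + (\<eta> - \<zeta>) *s axis k 1 :: complex ^ 6"
  have z: "\<zeta> * \<zeta> = - \<zeta> - 1" using zeta_sq by (simp add: power2_eq_square)
  have "?x \<in> S_hyp \<eta> \<zeta> p q" "?x \<notin> S_hyp \<eta> \<zeta> q p"
    using pq k zeta(3) unfolding S_hyp_L_kernel[OF pq(2,3)] S_hyp_L_kernel[OF pq(3,2)] L_kernel_def L_space_functional
    by (simp_all add: functional_linear functional_axis functional_axis_0 zeta_sq algebra_simps z)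
  then show ?thesis by blast
qed

text \<open>For an index m outside both pairs and x different from m, T_{m,x} lies on K_pq exactly
  when x is neither p nor q. Such an m exists because the two pairs cover at most four of the five
  indices.\<close>

lemma K_same_support:
  assumes pq: "p \<noteq> q" "p \<in> {1..5}" "q \<in> {1..5}" and rs: "r \<noteq> s" "r \<in> {1..5}" "s \<in> {1..5}"
    and eq: "K_hyp \<eta> p q = K_hyp \<eta> r s"
  shows "{p, q} = {r, s}"
proof -
  have iff: "(a \<in> {p, q} \<longleftrightarrow> b \<in> {p, q}) \<longleftrightarrow> (a \<in> {r, s} \<longleftrightarrow> b \<in> {r, s})"
    if "a \<noteq> b" "a \<in> {1..5}" "b \<in> {1..5}" for a b
  proof -
    have "T_vec {a, b} \<in> K_hyp \<eta> p q \<longleftrightarrow> (a \<in> {p, q} \<longleftrightarrow> b \<in> {p, q})" if pq: "p \<noteq> q" "p \<in> {1..5}" "q \<in> {1..5}" for p q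
      unfolding K_hyp_L_kernel[OF pq(2,3)] T_vec_in_kernel[OF \<eta> \<open>a \<noteq> b\<close> \<open>a \<in> {1..5}\<close> \<open>b \<in> {1..5}\<close>] using pq(1) by auto
    from this[OF pq] this[OF rs] eq show ?thesis by simp
  qed
  have "\<not> {1..5} \<subseteq> {p, q, r, s}"
  proof
    assume "{1..5} \<subseteq> {p, q, r, s}"
    then have "card ({1..5} :: 6 set) \<le> card {p, q, r, s}" by (intro card_mono) auto
    also have "\<dots> \<le> 4" using card_length[of "[p, q, r, s]"] by simp
    finally show False by (simp add: card_indices)
  qed
  then obtain m where m: "m \<in> {1..5}" "m \<notin> {p, q, r, s}" by blast
  then show ?thesis
    using iff[of m p] iff[of m q] iff[of m r] iff[of m s] pq rs by auto
qed

end

section \<open>The classification and the cardinalities\<close>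

theorem proposition7p3:
  fixes \<eta> \<zeta> :: complex
  assumes "\<eta>\<^sup>2 = -3"
    and "\<zeta> = (-1 + \<eta>) / 2"
  shows "FG_hyps \<eta> \<subseteq> steiner_hyperplanes_X \<eta> \<and>
         card (FG_hyps \<eta>) = 10 \<and>
         steiner_hyperplanes_X \<eta> - FG_hyps \<eta> =
           {K_hyp \<eta> p q |p q. 1 \<le> p \<and> p < q \<and> q \<le> 5} \<union>
           {S_hyp \<eta> \<zeta> p q |p q. p \<noteq> q \<and> p \<in> {1..5} \<and> q \<in> {1..5}} \<and>
         card (steiner_hyperplanes_X \<eta> - FG_hyps \<eta>) = 30"
proof -
  let ?I = "{1..5} :: 6 set"
  let ?KP = "{(p, q) |p q :: 6. 1 \<le> p \<and> p < q \<and> q \<le> 5}"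
  let ?SP = "{(p, q) |p q. p \<noteq> q \<and> p \<in> ?I \<and> q \<in> ?I}"
  define Ks where "Ks = {K_hyp \<eta> p q |p q. 1 \<le> p \<and> p < q \<and> q \<le> 5}"
  define Ss where "Ss = {S_hyp \<eta> \<zeta> p q |p q. p \<noteq> q \<and> p \<in> {1..5} \<and> q \<in> {1..5}}"
  note lone = lone_F[OF assms] lone_G[OF assms] lone_K[OF assms] lone_S[OF assms]
  have FG: "FG_hyps \<eta> = F_hyp \<eta> ` ?I \<union> G_hyp \<eta> ` ?I" unfolding FG_hyps_def by auto
  have K: "Ks = case_prod (K_hyp \<eta>) ` ?KP" unfolding Ks_def by auto
  have S: "Ss = case_prod (S_hyp \<eta> \<zeta>) ` ?SP" unfolding Ss_def by auto
  have FG_steiner: "FG_hyps \<eta> \<subseteq> steiner_hyperplanes_X \<eta>"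
    unfolding FG using F_steiner[OF assms] G_steiner[OF assms] by blast
  have KP: "p \<noteq> q" "p \<in> ?I" "q \<in> ?I" if "(p, q) \<in> ?KP" for p q using that by auto
  have "inj_on (F_hyp \<eta>) ?I" using lone(1) by (metis inj_onI singleton_inject)
  moreover have "inj_on (G_hyp \<eta>) ?I" using lone(2) by (metis inj_onI singleton_inject)
  moreover have "F_hyp \<eta> i \<noteq> G_hyp \<eta> j" if "i \<in> ?I" "j \<in> ?I" for i j
    using lone(1)[OF that(1)] lone(2)[OF that(2)] F_neq_G[OF assms that(1)] by (cases "i = j") auto
  then have "F_hyp \<eta> ` ?I \<inter> G_hyp \<eta> ` ?I = {}" by blast
  ultimately have card_FG: "card (FG_hyps \<eta>) = 10"
    unfolding FG by (subst card_Un_disjoint) (simp_all add: card_image card_indices)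
  have lone_FG: "\<exists>i. lone H = {i}" if "H \<in> FG_hyps \<eta>" for H
    using that lone(1,2) unfolding FG by blast
  have lone_K: "lone H = {}" if HK: "H \<in> Ks" for H
  proof -
    obtain p q where pq: "1 \<le> p" "p < q" "q \<le> 5" and H: "H = K_hyp \<eta> p q" using HK unfolding Ks_def by blast
    show ?thesis unfolding H by (rule lone(3)) (use pq in auto)
  qed
  have lone_S: "card (lone H) = 2" if HS: "H \<in> Ss" for H
  proof -
    obtain p q where pq: "p \<noteq> q" "p \<in> ?I" "q \<in> ?I" and H: "H = S_hyp \<eta> \<zeta> p q" using HS unfolding Ss_def by blast
    show ?thesis unfolding H lone(4)[OF pq] using pq(1) by simp
  qed
  have KS_FG: "(Ks \<union> Ss) \<inter> FG_hyps \<eta> = {}"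
  proof -
    have "H \<notin> FG_hyps \<eta>" if "H \<in> Ks \<union> Ss" for H
    proof
      assume "H \<in> FG_hyps \<eta>"
      then obtain i where "lone H = {i}" using lone_FG by blast
      then show False using that lone_K[of H] lone_S[of H] by (elim UnE) simp_all
    qed
    then show ?thesis by blast
  qed
  have KS: "Ks \<inter> Ss = {}"
  proof -
    have "H \<notin> Ss" if "H \<in> Ks" for H using lone_K[OF that] lone_S[of H] by force
    then show ?thesis by blast
  qed
  have K_sym: "K_hyp \<eta> p q = K_hyp \<eta> q p" for p q unfolding K_hyp_def by (simp add: add.commute)
  have "Ks \<union> Ss \<subseteq> steiner_hyperplanes_X \<eta>"
    unfolding Ks_def Ss_def using K_steiner[OF assms] S_steiner[OF assms] by auto
  moreover have "steiner_hyperplanes_X \<eta> \<subseteq> FG_hyps \<eta> \<union> (Ks \<union> Ss)"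
  proof
    fix H assume "H \<in> steiner_hyperplanes_X \<eta>"
    then show "H \<in> FG_hyps \<eta> \<union> (Ks \<union> Ss)"
    proof (cases rule: steiner_cases[OF assms, consumes 1, case_names F G K S])
      case (K p q)
      then have "p < q \<or> q < p" by auto
      then have "H \<in> Ks" using K K_sym[of p q] unfolding Ks_def by auto
      then show ?thesis by blast
    qed (unfold FG Ss_def, blast+)
  qed
  ultimately have rest: "steiner_hyperplanes_X \<eta> - FG_hyps \<eta> = Ks \<union> Ss"
    using KS_FG by blast
  have "inj_on (case_prod (K_hyp \<eta>)) ?KP"
  proof (clarsimp simp: inj_on_def)
    fix p q r s :: 6
    assume *: "1 \<le> p" "p < q" "q \<le> 5" "1 \<le> r" "r < s" "s \<le> 5" "K_hyp \<eta> p q = K_hyp \<eta> r s"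
    then have "{p, q} = {r, s}" by (intro K_same_support[OF assms]) auto
    then show "p = r \<and> q = s" using * by (auto simp: doubleton_eq_iff)
  qed
  moreover have "card ?KP = 10"
  proof -
    have "bij_betw (\<lambda>(p, q). {p, q}) ?KP (pairs ?I)"
    proof (rule bij_betwI')
      fix C assume "C \<in> pairs ?I"
      then obtain p q where C: "C = {p, q}" "p \<noteq> q" "p \<in> ?I" "q \<in> ?I" unfolding pairs_iff by blast
      then have "(p, q) \<in> ?KP \<or> (q, p) \<in> ?KP" by auto
      then show "\<exists>x\<in>?KP. C = (\<lambda>(p, q). {p, q}) x" using C(1) by auto
    next
      fix x assume x: "x \<in> ?KP"
      obtain p q where pq: "x = (p, q)" by (cases x)
      then have "p \<noteq> q" "p \<in> ?I" "q \<in> ?I" using x by auto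
      then show "(\<lambda>(p, q). {p, q}) x \<in> pairs ?I" unfolding pq pairs_iff by blast
    qed (auto simp: doubleton_eq_iff)
    then have "card ?KP = card (pairs ?I)" by (rule bij_betw_same_card)
    also have "\<dots> = 5 choose 2" unfolding pairs_def using n_subsets[of ?I 2] by (simp add: card_indices)
    finally show ?thesis by (simp add: choose_two)
  qed
  ultimately have card_K: "card Ks = 10" unfolding K by (simp add: card_image)
  have "inj_on (case_prod (S_hyp \<eta> \<zeta>)) ?SP"
  proof (clarsimp simp: inj_on_def)
    fix p q r s :: 6
    assume *: "p \<noteq> q" "1 \<le> p" "p \<le> 5" "1 \<le> q" "q \<le> 5" "r \<noteq> s" "1 \<le> r" "r \<le> 5" "1 \<le> s" "s \<le> 5"
      "S_hyp \<eta> \<zeta> p q = S_hyp \<eta> \<zeta> r s"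
    \<comment> \<open>\<open>lone\<close> recovers the unordered pair, and \<open>S_neq_swap\<close>
      then fixes its order.\<close>
    then have "{p, q} = {r, s}" using lone(4)[of p q] lone(4)[of r s] * by simp
    then show "p = r \<and> q = s" using * S_neq_swap[OF assms *(1)] by (auto simp: doubleton_eq_iff)
  qed
  moreover have "card ?SP = 20"
  proof -
    have "card ((\<lambda>p. (p, p)) ` ?I) = 5" by (subst card_image) (auto simp: inj_on_def card_indices)
    moreover have "?SP = ?I \<times> ?I - (\<lambda>p. (p, p)) ` ?I" by auto
    ultimately show ?thesis by (simp only:) (subst card_Diff_subset; auto simp: card_cartesian_product card_indices)
  qed
  ultimately have card_S: "card Ss = 20" unfolding S by (simp add: card_image)
  \<comment> \<open>Both sets are finite because their cardinalities are nonzero,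
    \<open>card\<close> being 0 on infinite sets.\<close>
  have "card (steiner_hyperplanes_X \<eta> - FG_hyps \<eta>) = 30"
    unfolding rest by (subst card_Un_disjoint[OF _ _ KS]) (use card_K card_S card.infinite in fastforce)+
  then show ?thesis using FG_steiner card_FG rest unfolding Ks_def Ss_def by (intro conjI)
qed

end
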